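(* Let $\pitchfork\colon\mathcal{S}\mathrm{Curr}(F_N)\times\mathcal{S}\mathrm{Curr}(F_N)\to\mathcal{S}\mathrm{Curr}(F_N)$ be an $\mathbb{R}_{\geq0}$-bilinear map such that for all nontrivial finitely generated subgroups $H,K\leq F_N$, \[ \pitchfork(\eta_H,\eta_K)=\sum_{HgK\in H\backslash F_N/K}\eta_{H\cap gKg^{-1}}.\] Then $\pitchfork$ is not continuous.
   Context: $N\geq 2$, $F_N$ free of rank $N$, $X$ its Cayley graph with respect to a free basis, $\partial X=\partial F_N$. $\mathcal{C}_N$: closed subsets of $\partial X$ with at least two points, Vietoris (Hausdorff) topology. $\mathcal{S}\mathrm{Curr}(F_N)$: $F_N$-invariant Borel measures on $\mathcal{C}_N$ finite on compact sets, with the weak-* topology. For nontrivial finitely generated $H$, $\eta_H=[\widehat H:H]\sum_{H'}\delta_{\Lambda(H')}$ with the sum over conjugates $H'$ of $\widehat H=\mathrm{Comm}_{F_N}(H)$ and $\Lambda$ the limit set in $\partial X$; $\eta_{\{1\}}=0$. Only finitely many terms of the sum are nonzero. *)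

theory Defs
  imports "HOL-Analysis.Analysis" "HOL-Algebra.Coset" "HOL-Algebra.Generated_Groups"
begin

type_synonym letter = "nat \<times> bool"   \<comment> \<open>(i, False) = a_i, (i, True) = a_i^{-1}\<close>
type_synonym word = "letter list"
type_synonym bpoint = "nat \<Rightarrow> letter"  \<comment> \<open>points of the boundary: infinite reduced words\<close>

definition inv_letter :: "letter \<Rightarrow> letter" where
  "inv_letter a = (fst a, \<not> snd a)"

definition reduced :: "nat \<Rightarrow> word \<Rightarrow> bool" where
  "reduced N w \<longleftrightarrow> (\<forall>a\<in>set w. fst a < N) \<and>
     (\<forall>i. Suc i < length w \<longrightarrow> w ! Suc i \<noteq> inv_letter (w ! i))"

definition cons_red :: "letter \<Rightarrow> word \<Rightarrow> word" where
  "cons_red a w = (case w of [] \<Rightarrow> [a] | b # w' \<Rightarrow> (if b = inv_letter a then w' else a # w))"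

definition mult_word :: "word \<Rightarrow> word \<Rightarrow> word" where
  "mult_word g h = foldr cons_red g h"

definition FN :: "nat \<Rightarrow> word monoid" where
  "FN N = \<lparr>carrier = {w. reduced N w}, mult = mult_word, one = []\<rparr>"

definition bdry :: "nat \<Rightarrow> bpoint set" where
  "bdry N = {\<xi>. (\<forall>i. fst (\<xi> i) < N) \<and> (\<forall>i. \<xi> (Suc i) \<noteq> inv_letter (\<xi> i))}"

definition cyl :: "nat \<Rightarrow> word \<Rightarrow> bpoint set" where
  "cyl N w = {\<zeta> \<in> bdry N. \<forall>i<length w. \<zeta> i = w ! i}"

definition bdry_top :: "nat \<Rightarrow> bpoint topology" where
  "bdry_top N = topology_generated_by (range (cyl N))"

definition act1 :: "letter \<Rightarrow> bpoint \<Rightarrow> bpoint" where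
  "act1 a \<xi> = (if \<xi> 0 = inv_letter a then (\<lambda>i. \<xi> (Suc i))
               else (\<lambda>i. if i = 0 then a else \<xi> (i - 1)))"

definition act :: "word \<Rightarrow> bpoint \<Rightarrow> bpoint" where
  "act g \<xi> = foldr act1 g \<xi>"

text \<open>Limit set of a subgroup: accumulation points in the boundary.\<close>
definition limset :: "nat \<Rightarrow> word set \<Rightarrow> bpoint set" where
  "limset N H = {\<xi> \<in> bdry N. \<forall>n. \<exists>h\<in>H. \<exists>w. h = map \<xi> [0..<n] @ w}"

definition CN :: "nat \<Rightarrow> bpoint set set" where
  "CN N = {A. closedin (bdry_top N) A \<and> (\<exists>x\<in>A. \<exists>y\<in>A. x \<noteq> y)}"

definition CN_top :: "nat \<Rightarrow> bpoint set topology" where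
  "CN_top N = topology_generated_by
     ({{A \<in> CN N. A \<subseteq> U} | U. openin (bdry_top N) U} \<union>
      {{A \<in> CN N. A \<inter> U \<noteq> {}} | U. openin (bdry_top N) U})"

definition CN_borel :: "nat \<Rightarrow> bpoint set measure" where
  "CN_borel N = sigma (CN N) {U. openin (CN_top N) U}"

definition SCurr :: "nat \<Rightarrow> bpoint set measure set" where
  "SCurr N = {\<mu>. sets \<mu> = sets (CN_borel N) \<and>
     (\<forall>g\<in>carrier (FN N). distr \<mu> \<mu> (\<lambda>A. act g ` A) = \<mu>) \<and>
     (\<forall>K. compactin (CN_top N) K \<longrightarrow> emeasure \<mu> K < \<infinity>)}"

definition Cc :: "nat \<Rightarrow> (bpoint set \<Rightarrow> real) set" where
  "Cc N = {f. continuous_map (CN_top N) euclideanreal f \<and>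
     compactin (CN_top N) ((CN_top N) closure_of {A \<in> CN N. f A \<noteq> 0})}"

definition SCurr_top :: "nat \<Rightarrow> bpoint set measure topology" where
  "SCurr_top N = topology_generated_by
     {{\<mu> \<in> SCurr N. (\<integral>A. f A \<partial>\<mu>) \<in> U} | f U. f \<in> Cc N \<and> open U}"

definition meas_add :: "nat \<Rightarrow> bpoint set measure \<Rightarrow> bpoint set measure \<Rightarrow> bpoint set measure" where
  "meas_add N \<mu> \<nu> = measure_of (CN N) (sets (CN_borel N)) (\<lambda>A. emeasure \<mu> A + emeasure \<nu> A)"

definition meas_scale :: "nat \<Rightarrow> real \<Rightarrow> bpoint set measure \<Rightarrow> bpoint set measure" where
  "meas_scale N c \<mu> = measure_of (CN N) (sets (CN_borel N)) (\<lambda>A. ennreal c * emeasure \<mu> A)"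

definition meas_sum :: "nat \<Rightarrow> 'i set \<Rightarrow> ('i \<Rightarrow> bpoint set measure) \<Rightarrow> bpoint set measure" where
  "meas_sum N I \<mu> = measure_of (CN N) (sets (CN_borel N))
     (\<lambda>A. \<integral>\<^sup>+ i. emeasure (\<mu> i) A \<partial>count_space I)"

definition meas_zero :: "nat \<Rightarrow> bpoint set measure" where
  "meas_zero N = measure_of (CN N) (sets (CN_borel N)) (\<lambda>A. 0)"

definition bilinear_SCurr :: "nat \<Rightarrow> (bpoint set measure \<Rightarrow> bpoint set measure \<Rightarrow> bpoint set measure) \<Rightarrow> bool" where
  "bilinear_SCurr N P \<longleftrightarrow>
     (\<forall>\<mu>\<in>SCurr N. \<forall>\<nu>\<in>SCurr N. P \<mu> \<nu> \<in> SCurr N) \<and>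
     (\<forall>\<mu>1\<in>SCurr N. \<forall>\<mu>2\<in>SCurr N. \<forall>\<nu>\<in>SCurr N.
        P (meas_add N \<mu>1 \<mu>2) \<nu> = meas_add N (P \<mu>1 \<nu>) (P \<mu>2 \<nu>) \<and>
        P \<nu> (meas_add N \<mu>1 \<mu>2) = meas_add N (P \<nu> \<mu>1) (P \<nu> \<mu>2)) \<and>
     (\<forall>c::real. c \<ge> 0 \<longrightarrow> (\<forall>\<mu>\<in>SCurr N. \<forall>\<nu>\<in>SCurr N.
        P (meas_scale N c \<mu>) \<nu> = meas_scale N c (P \<mu> \<nu>) \<and>
        P \<mu> (meas_scale N c \<nu>) = meas_scale N c (P \<mu> \<nu>)))"

definition conjg :: "nat \<Rightarrow> word \<Rightarrow> word set \<Rightarrow> word set" where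
  "conjg N g K = (\<lambda>k. g \<otimes>\<^bsub>FN N\<^esub> k \<otimes>\<^bsub>FN N\<^esub> inv\<^bsub>FN N\<^esub> g) ` K"

definition fin_index :: "nat \<Rightarrow> word set \<Rightarrow> word set \<Rightarrow> bool" where
  "fin_index N K H \<longleftrightarrow> finite (rcosets\<^bsub>(FN N)\<lparr>carrier := H\<rparr>\<^esub> K)"

definition index :: "nat \<Rightarrow> word set \<Rightarrow> word set \<Rightarrow> nat" where
  "index N K H = card (rcosets\<^bsub>(FN N)\<lparr>carrier := H\<rparr>\<^esub> K)"

definition commens :: "nat \<Rightarrow> word set \<Rightarrow> word set" where
  "commens N H = {g \<in> carrier (FN N).
      fin_index N (H \<inter> conjg N g H) H \<and> fin_index N (H \<inter> conjg N g H) (conjg N g H)}"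

definition fg_subgroup :: "nat \<Rightarrow> word set \<Rightarrow> bool" where
  "fg_subgroup N H \<longleftrightarrow> subgroup H (FN N) \<and>
     (\<exists>S. finite S \<and> S \<subseteq> carrier (FN N) \<and> H = generate (FN N) S)"

definition eta :: "nat \<Rightarrow> word set \<Rightarrow> bpoint set measure" where
  "eta N H = (if H = {\<one>\<^bsub>FN N\<^esub>} then meas_zero N else
     measure_of (CN N) (sets (CN_borel N))
       (\<lambda>A. of_nat (index N H (commens N H)) *
            (\<integral>\<^sup>+ H'. indicator A (limset N H')
               \<partial>count_space {conjg N g (commens N H) | g. g \<in> carrier (FN N)})))"

definition dcoset :: "nat \<Rightarrow> word set \<Rightarrow> word \<Rightarrow> word set \<Rightarrow> word set" where
  "dcoset N H g K = H <#>\<^bsub>FN N\<^esub> (g <#\<^bsub>FN N\<^esub> K)"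

definition dcosets :: "nat \<Rightarrow> word set \<Rightarrow> word set \<Rightarrow> word set set" where
  "dcosets N H K = (\<lambda>g. dcoset N H g K) ` carrier (FN N)"

definition dcoset_rep :: "nat \<Rightarrow> word set \<Rightarrow> word set \<Rightarrow> word set \<Rightarrow> word" where
  "dcoset_rep N H K D = (SOME g. g \<in> carrier (FN N) \<and> D = dcoset N H g K)"

end

theory Submission
  imports Defs
begin

text \<open>
  Already ordinary geodesic currents, i.e. cyclic subgroups, show the discontinuity. The axis of
  \<open>a\<^sup>n b\<close> follows an axis of \<open>a\<close> except for a fraction \<open>1/(n + 1)\<close> of its length, so
  \<open>\<eta>\<close> of \<open>\<langle>a\<^sup>n b\<rangle>\<close>, divided by \<open>n + 1\<close>, converges to \<open>\<eta>\<close> of \<open>\<langle>a\<rangle>\<close>. By exponent sums in \<open>b\<close>, \<open>\<langle>a\<^sup>n b\<rangle>\<close>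
  meets all conjugates of \<open>\<langle>a\<rangle>\<close> trivially, so pairing these currents with \<open>\<eta>\<close> of \<open>\<langle>a\<rangle>\<close> gives \<open>0\<close>; but
  pairing \<open>\<eta>\<close> of \<open>\<langle>a\<rangle>\<close> with itself charges the compact open set of closed sets which contain both a
  ray starting with \<open>a\<close> and a ray starting with \<open>a\<^sup>-\<^sup>1\<close>.

  To evaluate a counting current, the conjugates of \<open>\<langle>u\<rangle>\<close>, for a positive word \<open>u\<close> with pairwise
  distinct rotations, are parametrised by pairs \<open>(p, i)\<close>: the translated axis is closest to the base
  point at the vertex \<open>p\<close>, and it runs there along the \<open>i\<close>-th rotation of \<open>u\<close>.
\<close>

section \<open>Reduced words and the free group\<close>

text \<open>Positivity of the words keeps powers and rotations free of cancellation, and it gives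
  the two rays of an axis letters of opposite sign behind the path \<open>p\<close>. An axis is
  therefore recovered from its pair of ends. That all rotations of \<open>u\<close> differ says that
  \<open>u\<close> is not a proper power; then \<open>cyc N u\<close> is its own commensurator and
  the index in \<open>eta\<close> is 1. A test function with compact support vanishes on all lines
  whose path \<open>p\<close> exceeds a length depending only on the function. Its integrals against
  all currents in question are thus sums over one fixed finite set of paths, and for each path the
  limit concerns an average over \<open>n + 1\<close> rotations. For a given accuracy, all but a
  bounded number of these are close to the value for \<open>a\<close>. The other obstacle is
  topological: weak-* limits can be tested on a set only if its indicator is continuous with compact
  support. Compactness of the set used at the end rests on Koenig's lemma for the boundary and on
  Alexander's subbase theorem for the closed subsets.\<close>

lemma inv_letter_inv_letter [simp]: "inv_letter (inv_letter c) = c"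
  by (simp add: inv_letter_def)

lemma inv_letter_neq [simp]: "inv_letter c \<noteq> c" "c \<noteq> inv_letter c"
  by (auto simp: inv_letter_def prod_eq_iff)

lemma inv_letter_eq_iff [simp]: "inv_letter c = inv_letter d \<longleftrightarrow> c = d"
  by (metis inv_letter_inv_letter)

lemma eq_inv_letter_swap: "c = inv_letter d \<longleftrightarrow> d = inv_letter c"
  by (metis inv_letter_inv_letter)

lemma fst_inv_letter [simp]: "fst (inv_letter c) = fst c"
  by (simp add: inv_letter_def)

lemma snd_inv_letter [simp]: "snd (inv_letter c) = (\<not> snd c)"
  by (simp add: inv_letter_def)

lemma reduced_Nil [simp]: "reduced N []"
  by (simp add: reduced_def)

lemma reduced_append:
  "reduced N (v @ w) \<longleftrightarrow>
     reduced N v \<and> reduced N w \<and> (v = [] \<or> w = [] \<or> hd w \<noteq> inv_letter (last v))"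
proof (cases "v = [] \<or> w = []")
  case True
  then show ?thesis by auto
next
  case False
  then have vw: "v \<noteq> []" "w \<noteq> []" by auto
  have "(\<forall>i. Suc i < length (v @ w) \<longrightarrow> (v @ w) ! Suc i \<noteq> inv_letter ((v @ w) ! i)) \<longleftrightarrow>
     (\<forall>i. Suc i < length v \<longrightarrow> v ! Suc i \<noteq> inv_letter (v ! i)) \<and>
     (\<forall>i. Suc i < length w \<longrightarrow> w ! Suc i \<noteq> inv_letter (w ! i)) \<and> hd w \<noteq> inv_letter (last v)"
    (is "?L \<longleftrightarrow> ?A \<and> ?B \<and> ?C")
  proof
    assume L: ?L
    have ?A
    proof (intro allI impI)
      fix i assume i: "Suc i < length v"
      then show "v ! Suc i \<noteq> inv_letter (v ! i)"
        using L[rule_format, of i] by (auto simp: nth_append)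
    qed
    moreover have ?B
    proof (intro allI impI)
      fix i assume i: "Suc i < length w"
      then show "w ! Suc i \<noteq> inv_letter (w ! i)"
        using L[rule_format, of "length v + i"] by (auto simp: nth_append)
    qed
    moreover have ?C
      using L[rule_format, of "length v - 1"] vw
      by (auto simp: nth_append hd_conv_nth last_conv_nth)
    ultimately show "?A \<and> ?B \<and> ?C" by blast
  next
    assume R: "?A \<and> ?B \<and> ?C"
    show ?L
    proof (intro allI impI)
      fix i assume i: "Suc i < length (v @ w)"
      consider "Suc i < length v" | "Suc i = length v" | "i \<ge> length v" by linarith
      then show "(v @ w) ! Suc i \<noteq> inv_letter ((v @ w) ! i)"
      proof cases
        case 1 then show ?thesis using R by (auto simp: nth_append)
      next
        case 2
        then have "i = length v - 1" by simp
        with 2 show ?thesis using R vw by (auto simp: nth_append hd_conv_nth last_conv_nth)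
      next
        case 3
        then show ?thesis using R i
          by (simp add: nth_append Suc_diff_le)
      qed
    qed
  qed
  then show ?thesis using vw unfolding reduced_def by auto
qed

lemma reduced_single [simp]: "reduced N [c] \<longleftrightarrow> fst c < N"
  by (simp add: reduced_def)

lemma reduced_Cons:
  "reduced N (c # w) \<longleftrightarrow> fst c < N \<and> reduced N w \<and> (w = [] \<or> hd w \<noteq> inv_letter c)"
  using reduced_append[of N "[c]" w] by simp

lemma reduced_letter: "reduced N w \<Longrightarrow> c \<in> set w \<Longrightarrow> fst c < N"
  by (simp add: reduced_def)

lemma reduced_cons_red: "reduced N w \<Longrightarrow> fst c < N \<Longrightarrow> reduced N (cons_red c w)"
  by (cases w) (auto simp: cons_red_def reduced_Cons)

lemma mult_word_Nil [simp]: "mult_word [] h = h"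
  by (simp add: mult_word_def)

lemma mult_word_Cons [simp]: "mult_word (c # g) h = cons_red c (mult_word g h)"
  by (simp add: mult_word_def)

lemma reduced_mult_word:
  "\<forall>c\<in>set g. fst c < N \<Longrightarrow> reduced N h \<Longrightarrow> reduced N (mult_word g h)"
  by (induction g) (auto intro: reduced_cons_red)

lemma reduced_mult: "reduced N g \<Longrightarrow> reduced N h \<Longrightarrow> reduced N (mult_word g h)"
  by (intro reduced_mult_word) (auto dest: reduced_letter)

text \<open>Reducedness matters if \<open>w\<close> starts with \<open>c\<close>: once that letter
  is cancelled, the rest does not start with \<open>inv_letter c\<close>, so \<open>c\<close> is
  simply put back.\<close>

lemma cons_red_cancel:
  "reduced N w \<Longrightarrow> cons_red c (cons_red (inv_letter c) w) = w"
  by (cases w) (auto simp: cons_red_def reduced_Cons split: list.splits)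

lemma cons_red_reduced: "reduced N (c # w) \<Longrightarrow> cons_red c w = c # w"
  by (cases w) (auto simp: cons_red_def reduced_Cons)

lemma mult_word_reduced_append: "reduced N (g @ h) \<Longrightarrow> mult_word g h = g @ h"
proof (induction g)
  case (Cons c g)
  then have "mult_word g h = g @ h" by (simp add: reduced_Cons)
  then show ?case using Cons.prems cons_red_reduced by simp
qed simp

text \<open>Van der Waerden's argument for associativity: each letter acts on reduced words with the
  inverse letter acting as its inverse, so cancelling inside the left factor does not change the
  result.\<close>

lemma mult_word_cons_red:
  assumes "\<forall>c\<in>set g. fst c < N" "fst c < N" "reduced N h"
  shows "mult_word (cons_red c g) h = cons_red c (mult_word g h)"
proof (cases g)
  case (Cons b g')
  have "reduced N (mult_word g' h)"
    using assms Cons by (intro reduced_mult_word) auto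
  then have *: "cons_red c (cons_red (inv_letter c) (mult_word g' h)) = mult_word g' h"
    by (rule cons_red_cancel)
  show ?thesis
  proof (cases "b = inv_letter c")
    case True
    then have "cons_red c g = g'" using Cons by (simp add: cons_red_def)
    then show ?thesis using * Cons True by simp
  next
    case False
    then have "cons_red c g = c # g" using Cons by (simp add: cons_red_def)
    then show ?thesis by simp
  qed
qed (auto simp: cons_red_def)

lemma mult_word_assoc:
  assumes "\<forall>c\<in>set g. fst c < N" "reduced N h" "reduced N k"
  shows "mult_word (mult_word g h) k = mult_word g (mult_word h k)"
  using assms(1)
proof (induction g)
  case (Cons c g)
  have "reduced N (mult_word g h)" using Cons assms by (intro reduced_mult_word) auto
  then show ?case using Cons assms mult_word_cons_red[of "mult_word g h" N c k]
    by (auto simp: reduced_letter)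
qed simp

lemma mult_assoc:
  assumes "reduced N g" "reduced N h" "reduced N k"
  shows "mult_word (mult_word g h) k = mult_word g (mult_word h k)"
  using assms by (intro mult_word_assoc) (auto dest: reduced_letter)

definition winv :: "word \<Rightarrow> word" where
  "winv w = rev (map inv_letter w)"

lemma winv_simps [simp]:
  "winv [] = []" "winv (v @ w) = winv w @ winv v" "winv (c # w) = winv w @ [inv_letter c]"
  "length (winv w) = length w" "winv w = [] \<longleftrightarrow> w = []" "[] = winv w \<longleftrightarrow> w = []"
  "set (winv w) = inv_letter ` set w"
  by (auto simp: winv_def)

lemma winv_winv [simp]: "winv (winv w) = w"
  by (induction w) auto

lemma hd_winv: "w \<noteq> [] \<Longrightarrow> hd (winv w) = inv_letter (last w)"
  by (simp add: winv_def hd_rev last_map)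

lemma last_winv: "w \<noteq> [] \<Longrightarrow> last (winv w) = inv_letter (hd w)"
  by (simp add: winv_def last_rev hd_map)

lemma reduced_winv [simp]: "reduced N (winv w) \<longleftrightarrow> reduced N w"
proof -
  have "reduced N w \<Longrightarrow> reduced N (winv w)" for w
    by (induction w) (auto simp: reduced_Cons reduced_append last_winv)
  from this[of w] this[of "winv w"] show ?thesis by auto
qed

lemma mult_word_append: "mult_word (g @ h) k = mult_word g (mult_word h k)"
  by (simp add: mult_word_def)

lemma mult_word_winv: "reduced N w \<Longrightarrow> mult_word (winv w) w = []"
proof (induction w)
  case (Cons c w)
  then have "reduced N w" by (simp add: reduced_Cons)
  then show ?case using Cons
    by (simp add: mult_word_append cons_red_def)
qed simp

lemma FN_simps [simp]:
  "carrier (FN N) = {w. reduced N w}" "g \<otimes>\<^bsub>FN N\<^esub> h = mult_word g h" "\<one>\<^bsub>FN N\<^esub> = []"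
  by (simp_all add: FN_def)

interpretation FN: group "FN N" for N
proof (rule groupI)
  fix x y z assume "x \<in> carrier (FN N)" "y \<in> carrier (FN N)" "z \<in> carrier (FN N)"
  then show "x \<otimes>\<^bsub>FN N\<^esub> y \<otimes>\<^bsub>FN N\<^esub> z = x \<otimes>\<^bsub>FN N\<^esub> (y \<otimes>\<^bsub>FN N\<^esub> z)"
    by (auto intro: mult_word_assoc dest: reduced_letter)
next
  fix x assume "x \<in> carrier (FN N)"
  then show "\<exists>y\<in>carrier (FN N). y \<otimes>\<^bsub>FN N\<^esub> x = \<one>\<^bsub>FN N\<^esub>"
    by (intro bexI[of _ "winv x"]) (auto intro: mult_word_winv)
qed (auto intro: reduced_mult_word dest: reduced_letter)

lemma inv_FN: "reduced N w \<Longrightarrow> inv\<^bsub>FN N\<^esub> w = winv w"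
  by (rule FN.inv_equality) (auto intro: mult_word_winv)

section \<open>Conjugation of subsets and subgroups\<close>

lemma conjg_eq: "reduced N g \<Longrightarrow> conjg N g K = (\<lambda>k. mult_word (mult_word g k) (winv g)) ` K"
  by (simp add: conjg_def inv_FN)

lemma conjg_mult:
  assumes "reduced N g" "reduced N h" "K \<subseteq> carrier (FN N)"
  shows "conjg N (mult_word g h) K = conjg N g (conjg N h K)"
proof -
  have "mult_word (mult_word (mult_word g h) k) (inv\<^bsub>FN N\<^esub> (mult_word g h)) =
    mult_word (mult_word g (mult_word (mult_word h k) (inv\<^bsub>FN N\<^esub> h))) (inv\<^bsub>FN N\<^esub> g)"
    if "k \<in> K" for k
  proof -
    have k: "k \<in> carrier (FN N)" "g \<in> carrier (FN N)" "h \<in> carrier (FN N)"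
      using that assms by auto
    then have "(g \<otimes>\<^bsub>FN N\<^esub> h) \<otimes>\<^bsub>FN N\<^esub> k \<otimes>\<^bsub>FN N\<^esub> inv\<^bsub>FN N\<^esub> (g \<otimes>\<^bsub>FN N\<^esub> h) =
       g \<otimes>\<^bsub>FN N\<^esub> (h \<otimes>\<^bsub>FN N\<^esub> k \<otimes>\<^bsub>FN N\<^esub> inv\<^bsub>FN N\<^esub> h) \<otimes>\<^bsub>FN N\<^esub> inv\<^bsub>FN N\<^esub> g"
      by (simp add: FN.inv_mult_group FN.m_assoc del: FN_simps)
    then show ?thesis by simp
  qed
  then show ?thesis
    unfolding conjg_def image_image FN_simps by (intro image_cong refl)
qed

lemma conjg_subset: "reduced N g \<Longrightarrow> K \<subseteq> carrier (FN N) \<Longrightarrow> conjg N g K \<subseteq> carrier (FN N)"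
  by (auto simp: conjg_eq intro!: reduced_mult)

lemma conjg_Nil: "K \<subseteq> carrier (FN N) \<Longrightarrow> conjg N [] K = K"
proof -
  assume K: "K \<subseteq> carrier (FN N)"
  then have "mult_word (mult_word [] k) (winv []) = k" if "k \<in> K" for k
    using mult_word_reduced_append[of N k "[]"] that by auto
  then show ?thesis by (simp add: conjg_eq)
qed

lemma conjg_cancel:
  assumes "reduced N g" "K \<subseteq> carrier (FN N)"
  shows "conjg N (winv g) (conjg N g K) = K" "conjg N g (conjg N (winv g) K) = K"
  using assms conjg_mult[of N "winv g" g K] conjg_mult[of N g "winv g" K]
    mult_word_winv[of N g] mult_word_winv[of N "winv g"]
  by (simp_all add: conjg_Nil)

lemma conjg_mono: "H \<subseteq> K \<Longrightarrow> conjg N g H \<subseteq> conjg N g K"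
  unfolding conjg_def by auto

lemma conjg_subgroup_self:
  assumes "subgroup H (FN N)" "h \<in> H"
  shows "conjg N h H = H"
proof -
  interpret H: subgroup H "FN N" by fact
  have "conjg N h H \<subseteq> H" if "h \<in> H" for h
    unfolding conjg_def using that by (intro image_subsetI H.m_closed H.m_inv_closed)
  from this[OF assms(2)] this[OF H.m_inv_closed[OF assms(2)]]
  have a: "conjg N h H \<subseteq> H" "conjg N (winv h) H \<subseteq> H"
    using H.subset assms(2) inv_FN[of N h] by (auto simp: subset_iff)
  have "H = conjg N h (conjg N (winv h) H)"
    using conjg_cancel[of N h H] H.subset assms(2) by auto
  also have "\<dots> \<subseteq> conjg N h H" by (rule conjg_mono[OF a(2)])
  finally show ?thesis using a by auto
qed

section \<open>Limit sets of conjugates of cyclic subgroups\<close>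

text \<open>Powers of such a word are literal concatenations, and the sign of a letter tells the
  forward ray of the axis from the backward one.\<close>

definition positive_word :: "nat \<Rightarrow> word \<Rightarrow> bool" where
  "positive_word N w \<longleftrightarrow> w \<noteq> [] \<and> (\<forall>c\<in>set w. fst c < N \<and> \<not> snd c)"

definition wpow :: "word \<Rightarrow> nat \<Rightarrow> word" where
  "wpow w k = concat (replicate k w)"

definition per :: "word \<Rightarrow> bpoint" where
  "per w i = w ! (i mod length w)"

text \<open>Concatenation without cancellation. It represents the translate of the ray by
  \<open>p\<close> when the junction is reduced, which is what \<open>adm\<close> provides for both
  rays of an axis.\<close>

definition prep :: "word \<Rightarrow> bpoint \<Rightarrow> bpoint" where
  "prep p \<xi> i = (if i < length p then p ! i else \<xi> (i - length p))"

text \<open>The path \<open>p\<close> meets the axis of \<open>v\<close> through the base point only in its endpoint, so that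
  both rays \<open>p v v v \<dots>\<close> and \<open>p v\<^sup>-\<^sup>1 v\<^sup>-\<^sup>1 v\<^sup>-\<^sup>1 \<dots>\<close> are reduced.\<close>
definition adm :: "word \<Rightarrow> word \<Rightarrow> bool" where
  "adm p v \<longleftrightarrow> p = [] \<or> (last p \<noteq> inv_letter (hd v) \<and> last p \<noteq> last v)"

definition line :: "word \<Rightarrow> word \<Rightarrow> bpoint set" where
  "line p v = {prep p (per v), prep p (per (winv v))}"

abbreviation cyc :: "nat \<Rightarrow> word \<Rightarrow> word set" where
  "cyc N v \<equiv> generate (FN N) {v}"

lemma wpow_0 [simp]: "wpow w 0 = []"
  by (simp add: wpow_def)

lemma wpow_Suc [simp]: "wpow w (Suc k) = w @ wpow w k"
  by (simp add: wpow_def)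

lemma wpow_Suc_right: "wpow w (Suc k) = wpow w k @ w"
  by (induction k) auto

lemma length_wpow [simp]: "length (wpow w k) = k * length w"
  by (induction k) auto

lemma set_wpow: "set (wpow w k) \<subseteq> set w"
  by (induction k) auto

lemma wpow_eq_Nil [simp]: "wpow w k = [] \<longleftrightarrow> w = [] \<or> k = 0"
  by (induction k) auto

lemma hd_wpow: "k > 0 \<Longrightarrow> w \<noteq> [] \<Longrightarrow> hd (wpow w k) = hd w"
  by (cases k) auto

lemma last_wpow: "k > 0 \<Longrightarrow> w \<noteq> [] \<Longrightarrow> last (wpow w k) = last w"
  by (cases k) (auto simp: wpow_Suc_right simp del: wpow_Suc)

lemma winv_wpow: "winv (wpow w k) = wpow (winv w) k"
proof (induction k)
  case (Suc k)
  then have "winv (wpow w (Suc k)) = wpow (winv w) k @ winv w" by simp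
  then show ?case by (simp only: wpow_Suc_right)
qed simp

lemma nth_wpow: "i < k * length w \<Longrightarrow> wpow w k ! i = w ! (i mod length w)"
proof (induction k arbitrary: i)
  case (Suc k)
  show ?case
  proof (cases "i < length w")
    case False
    then have "wpow w (Suc k) ! i = wpow w k ! (i - length w)" by (simp add: nth_append)
    also have "\<dots> = w ! ((i - length w) mod length w)" using Suc False by simp
    finally show ?thesis using False by (simp add: le_mod_geq)
  qed (simp add: nth_append)
qed simp

lemma reduced_positive: "positive_word N w \<Longrightarrow> reduced N w"
  by (auto simp: positive_word_def reduced_def)
    (metis Suc_lessD nth_mem snd_inv_letter)

lemma positive_wpow: "positive_word N w \<Longrightarrow> k > 0 \<Longrightarrow> positive_word N (wpow w k)"
  using set_wpow[of w k] by (auto simp: positive_word_def)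

lemma reduced_wpow: "positive_word N w \<Longrightarrow> reduced N (wpow w k)"
  by (cases "k = 0") (auto intro: reduced_positive positive_wpow)

lemma nat_pow_positive:
  assumes "positive_word N w"
  shows "w [^]\<^bsub>FN N\<^esub> (k::nat) = wpow w k"
proof (induction k)
  case (Suc k)
  have "reduced N (wpow w k @ w)"
    using reduced_wpow[OF assms, of "Suc k"] by (simp only: wpow_Suc_right)
  then have "mult_word (wpow w k) w = wpow w (Suc k)"
    by (simp only: wpow_Suc_right mult_word_reduced_append)
  then show ?case using Suc by simp
qed simp

lemma cyc_positive:
  assumes "positive_word N v"
  shows "cyc N v = range (wpow v) \<union> range (wpow (winv v))"
proof -
  have v: "v \<in> carrier (FN N)" using reduced_positive[OF assms] by simp
  have pos: "v [^]\<^bsub>FN N\<^esub> (int k) = wpow v k" for k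
    by (simp add: int_pow_int nat_pow_positive[OF assms])
  have neg: "v [^]\<^bsub>FN N\<^esub> (- int k) = wpow (winv v) k" for k
    using FN.int_pow_neg[OF v, of "int k"] pos[of k] inv_FN[OF reduced_wpow[OF assms]]
    by (simp add: winv_wpow)
  show ?thesis unfolding FN.generate_pow[OF v]
  proof (intro equalityI subsetI)
    fix x assume "x \<in> {v [^]\<^bsub>FN N\<^esub> (k::int) |k. k \<in> UNIV}"
    then obtain k :: int where k: "x = v [^]\<^bsub>FN N\<^esub> k" by auto
    show "x \<in> range (wpow v) \<union> range (wpow (winv v))"
      using pos neg unfolding k by (cases k rule: int_cases2) auto
  next
    fix x assume "x \<in> range (wpow v) \<union> range (wpow (winv v))"
    then show "x \<in> {v [^]\<^bsub>FN N\<^esub> (k::int) |k. k \<in> UNIV}"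
      by (auto simp only: pos[symmetric] neg[symmetric])
  qed
qed

lemma cyc_subset: "positive_word N v \<Longrightarrow> cyc N v \<subseteq> carrier (FN N)"
  by (rule FN.generate_incl) (auto dest: reduced_positive)

lemma subgroup_cyc: "positive_word N v \<Longrightarrow> subgroup (cyc N v) (FN N)"
  by (rule FN.generate_is_subgroup) (auto dest: reduced_positive)

text \<open>Replacing \<open>v\<close> by \<open>winv v\<close> exchanges the two inequalities in
  \<open>adm\<close>, so both directions of the axis, and both junctions of a conjugated power, are
  covered at once.\<close>

lemma adm_positive_hd_last:
  assumes "positive_word N v" "adm p v" "w \<in> {v, winv v}" "p \<noteq> []"
  shows "hd w \<noteq> inv_letter (last p)" "inv_letter (last p) \<noteq> inv_letter (last w)"
  using assms by (auto simp: adm_def positive_word_def hd_winv last_winv)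

lemma reduced_conj_wpow:
  assumes "positive_word N v" "reduced N p" "adm p v" "w \<in> {v, winv v}" "k > 0"
  shows "reduced N (p @ wpow w k @ winv p)"
proof -
  have w: "w \<noteq> []" "reduced N (wpow w k)"
    using assms reduced_wpow[of N v k] by (auto simp: positive_word_def simp flip: winv_wpow)
  show ?thesis
    using w assms adm_positive_hd_last[OF assms(1,3,4)]
    by (auto simp: reduced_append hd_wpow last_wpow hd_winv)
qed

text \<open>For \<open>k > 0\<close> nothing cancels in \<open>p @ wpow w k @ winv p\<close>, so the
  product is the literal list. For \<open>k = 0\<close> everything cancels, whence the separate
  element \<open>[]\<close>.\<close>

lemma conjg_cyc:
  assumes "positive_word N v" "reduced N p" "adm p v"
  shows "conjg N p (cyc N v) = insert [] {p @ wpow w k @ winv p | w k. w \<in> {v, winv v} \<and> k > 0}"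
proof -
  have *: "mult_word (mult_word p (wpow w k)) (winv p) = (if k = 0 then [] else p @ wpow w k @ winv p)"
    if "w \<in> {v, winv v}" for w k
  proof (cases "k = 0")
    case True
    then show ?thesis
      using mult_word_reduced_append[of N p "[]"] mult_word_winv[of N "winv p"] assms by simp
  next
    case False
    then have "reduced N ((p @ wpow w k) @ winv p)"
      using reduced_conj_wpow[OF assms that] by simp
    moreover from this have "reduced N (p @ wpow w k)" using reduced_append by blast
    ultimately show ?thesis using mult_word_reduced_append False by simp
  qed
  show ?thesis
    unfolding conjg_eq[OF assms(2)] cyc_positive[OF assms(1)] image_Un image_image
    by (auto simp: * image_iff intro: exI[of _ "0::nat"])
qed

lemma prefix_ex_iff:
  "(\<exists>w. h = map \<xi> [0..<n] @ w) \<longleftrightarrow> n \<le> length h \<and> (\<forall>i<n. h ! i = \<xi> i)"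
proof
  assume "\<exists>w. h = map \<xi> [0..<n] @ w"
  then show "n \<le> length h \<and> (\<forall>i<n. h ! i = \<xi> i)" by (auto simp: nth_append)
next
  assume R: "n \<le> length h \<and> (\<forall>i<n. h ! i = \<xi> i)"
  then have "take n h = map \<xi> [0..<n]" by (intro nth_equalityI) auto
  then show "\<exists>w. h = map \<xi> [0..<n] @ w" by (metis append_take_drop_id)
qed

lemma limset_iff:
  "\<xi> \<in> limset N H \<longleftrightarrow> \<xi> \<in> bdry N \<and> (\<forall>n. \<exists>h\<in>H. n \<le> length h \<and> (\<forall>i<n. h ! i = \<xi> i))"
  by (simp add: limset_def prefix_ex_iff)

lemma bdry_prefixI:
  assumes "\<And>n. \<exists>h. reduced N h \<and> n \<le> length h \<and> (\<forall>i<n. h ! i = \<xi> i)"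
  shows "\<xi> \<in> bdry N"
proof -
  have "fst (\<xi> i) < N \<and> \<xi> (Suc i) \<noteq> inv_letter (\<xi> i)" for i
  proof -
    obtain h where h: "reduced N h" "i + 2 \<le> length h" "\<And>j. j < i + 2 \<Longrightarrow> h ! j = \<xi> j"
      using assms[of "i + 2"] by auto
    have "h ! i = \<xi> i" "h ! Suc i = \<xi> (Suc i)" using h(3) by auto
    moreover have "h ! i \<in> set h" using h(2) by (intro nth_mem) auto
    moreover have "Suc i < length h" using h(2) by simp
    ultimately show ?thesis using h(1) unfolding reduced_def by metis
  qed
  then show ?thesis by (simp add: bdry_def)
qed

lemma nth_prep_per:
  assumes "i < length p + k * length w"
  shows "(p @ wpow w k @ q) ! i = prep p (per w) i"
  using assms by (auto simp: nth_append prep_def per_def nth_wpow)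

text \<open>A long element of the conjugate follows one of the two rays until its closing segment
  \<open>winv p\<close>; conversely, growing powers exhaust both rays.\<close>

lemma limset_conj_cyc:
  assumes v: "positive_word N v" and p: "reduced N p" "adm p v"
  shows "limset N (conjg N p (cyc N v)) = line p v"
proof -
  define H where "H = conjg N p (cyc N v)"
  note H = H_def[unfolded conjg_cyc[OF v p]]
  have len: "length w > 0" if "w \<in> {v, winv v}" for w
    using that v by (auto simp: positive_word_def)
  have in1: "prep p (per w) \<in> limset N H" if w: "w \<in> {v, winv v}" for w
  proof -
    have *: "\<exists>h\<in>H. reduced N h \<and> n \<le> length h \<and> (\<forall>i<n. h ! i = prep p (per w) i)" for n
    proof (intro bexI[of _ "p @ wpow w (Suc n) @ winv p"] conjI allI impI)
      show "reduced N (p @ wpow w (Suc n) @ winv p)"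
        using reduced_conj_wpow[OF v p w] by blast
      have n: "n \<le> Suc n * length w" using len[OF w] by (cases "length w") auto
      then show "n \<le> length (p @ wpow w (Suc n) @ winv p)" by simp
      show "(p @ wpow w (Suc n) @ winv p) ! i = prep p (per w) i" if "i < n" for i
        using n that by (intro nth_prep_per) linarith
      show "p @ wpow w (Suc n) @ winv p \<in> H" unfolding H using w by blast
    qed
    show ?thesis unfolding limset_iff
      using * by (intro conjI bdry_prefixI) (meson+)
  qed
  have in2: "\<xi> \<in> line p v" if \<xi>: "\<xi> \<in> limset N H" for \<xi>
  proof -
    have ex: "\<exists>w\<in>{v, winv v}. \<forall>i<n. \<xi> i = prep p (per w) i" for n
    proof -
      \<comment> \<open>The extra \<open>length p\<close> keeps the first \<open>n\<close> letters
        clear of the closing \<open>winv p\<close>, and the extra 1 excludes the empty word.\<close>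
      obtain h where h: "h \<in> H" "n + length p + 1 \<le> length h" "\<And>i. i < n + length p + 1 \<Longrightarrow> h ! i = \<xi> i"
        using \<xi> unfolding limset_iff by meson
      then obtain w k where w: "w \<in> {v, winv v}" "h = p @ wpow w k @ winv p"
        unfolding H by auto
      have "\<xi> i = prep p (per w) i" if "i < n" for i
      proof -
        have "i < length p + k * length w" using h(2) w(2) that by simp
        then show ?thesis using h(3)[of i] that nth_prep_per[of i p k w] w(2) by simp
      qed
      then show ?thesis using w(1) by blast
    qed
    show ?thesis
    \<comment> \<open>The direction \<open>w\<close> found by \<open>ex\<close> may depend on
      \<open>n\<close>. A point off both rays disagrees with them at some positions \<open>i\<close>
      and \<open>j\<close>; a prefix reaching beyond both then fits neither ray.\<close>
    proof (rule ccontr)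
      assume "\<xi> \<notin> line p v"
      then obtain i j where "\<xi> i \<noteq> prep p (per v) i" "\<xi> j \<noteq> prep p (per (winv v)) j"
        unfolding line_def insert_iff fun_eq_iff by blast
      then show False using ex[of "Suc (max i j)"] by (auto simp: less_Suc_eq_le)
    qed
  qed
  show ?thesis using in1 in2 unfolding H_def[symmetric] line_def by blast
qed

lemma per_letter: "w \<noteq> [] \<Longrightarrow> per w i \<in> set w"
  by (simp add: per_def)

lemma positive_per:
  assumes "positive_word N v"
  shows "\<not> snd (per v i)" "snd (per (winv v) i)"
  using assms per_letter[of v i] per_letter[of "winv v" i] by (auto simp: positive_word_def)

lemma prep_nth_ge: "prep p \<xi> (length p + i) = \<xi> i"
  by (simp add: prep_def)

text \<open>The path \<open>p\<close> is exactly the common prefix of the two rays, since right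
  behind it their letters have opposite signs. The same sign then singles out the forward ray, which
  gives the period.\<close>

lemma line_inj:
  assumes v: "positive_word N v" and w: "positive_word N w" and eq: "line p v = line q w"
  shows "p = q" and "per v = per w"
proof -
  have le: "length q \<le> length p" if v: "positive_word N v" and eq: "line p v = line q w" for p q v w
  proof (rule ccontr)
    assume "\<not> length q \<le> length p"
    then have "x (length p) = y (length p)" if "x \<in> line q w" "y \<in> line q w" for x y
      using that by (auto simp: line_def prep_def)
    then have "prep p (per v) (length p) = prep p (per (winv v)) (length p)"
      using eq unfolding line_def by auto
    then show False using positive_per[OF v, of 0] by (simp add: prep_def)
  qed
  have len: "length p = length q" using le[OF v eq] le[OF w eq[symmetric]] by simp
  have x: "prep p (per v) \<in> line q w" using eq by (auto simp: line_def)
  then obtain y where y: "prep p (per v) = prep q y" by (auto simp: line_def)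
  have "p ! i = q ! i" if "i < length p" for i
    using fun_cong[OF y, of i] that len by (simp add: prep_def)
  then show pq: "p = q" using len by (intro nth_equalityI) auto
  have "prep p (per v) \<noteq> prep q (per (winv w))"
    using positive_per(1)[OF v, of 0] positive_per(2)[OF w, of 0] pq
    by (metis add.right_neutral prep_nth_ge)
  then have "prep p (per v) = prep q (per w)" using x by (auto simp: line_def)
  then have "per v i = per w i" for i
    using prep_nth_ge[of p "per v" i] prep_nth_ge[of q "per w" i] pq by simp
  then show "per v = per w" by (rule ext)
qed

lemma per_inj:
  assumes "per v = per w" "length v = length w"
  shows "v = w"
proof (rule nth_equalityI)
  fix i assume "i < length v"
  moreover have "per v i = per w i" by (simp add: assms(1))
  ultimately show "v ! i = w ! i" using assms(2) by (simp add: per_def)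
qed (fact assms(2))

lemma line_subset_bdry:
  assumes "positive_word N v" "reduced N p" "adm p v"
  shows "line p v \<subseteq> bdry N"
  using limset_conj_cyc[OF assms] by (auto simp: limset_def)

lemma line_two_points:
  assumes "positive_word N v"
  shows "prep p (per v) \<noteq> prep p (per (winv v))"
  using positive_per[OF assms, of 0] by (metis add.right_neutral prep_nth_ge)

section \<open>Conjugates and commensurators of cyclic subgroups\<close>

text \<open>The rotations are pairwise distinct precisely when \<open>u\<close> is not a proper
  power, so \<open>u\<close> generates a maximal cyclic subgroup.\<close>

definition simple_word :: "nat \<Rightarrow> word \<Rightarrow> bool" where
  "simple_word N u \<longleftrightarrow> positive_word N u \<and> inj_on (\<lambda>i. rotate i u) {..<length u}"

definition params :: "nat \<Rightarrow> word \<Rightarrow> (word \<times> nat) set" where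
  "params N u = {(p, i). reduced N p \<and> i < length u \<and> adm p (rotate i u)}"

lemma positive_rotate: "positive_word N u \<Longrightarrow> positive_word N (rotate i u)"
  by (simp add: positive_word_def)

lemma positive_subset_reduced: "positive_word N u \<Longrightarrow> set w \<subseteq> set u \<Longrightarrow> reduced N w"
proof (cases "w = []")
  case False
  assume "positive_word N u" "set w \<subseteq> set u"
  with False have "positive_word N w" unfolding positive_word_def by blast
  then show ?thesis by (rule reduced_positive)
qed simp

lemma conjg_generate:
  assumes "reduced N g" "S \<subseteq> carrier (FN N)"
  shows "conjg N g (generate (FN N) S) = generate (FN N) (conjg N g S)"
proof -
  have g: "g \<in> carrier (FN N)" using assms by simp
  let ?f = "\<lambda>k. g \<otimes>\<^bsub>FN N\<^esub> k \<otimes>\<^bsub>FN N\<^esub> inv\<^bsub>FN N\<^esub> g"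
  have "?f \<in> hom (FN N) (FN N)"
  proof (rule homI)
    fix x y assume "x \<in> carrier (FN N)" "y \<in> carrier (FN N)"
    with g show "?f (x \<otimes>\<^bsub>FN N\<^esub> y) = ?f x \<otimes>\<^bsub>FN N\<^esub> ?f y"
      by (simp add: FN.m_assoc FN.inv_solve_left' del: FN_simps)
        (metis FN.inv_closed FN.l_inv FN.m_assoc FN.m_closed FN.l_one)
  qed (use g in \<open>simp del: FN_simps\<close>)
  then interpret group_hom "FN N" "FN N" ?f by unfold_locales
  show ?thesis using generate_img[OF assms(2)] by (simp add: conjg_def)
qed

text \<open>With \<open>u = x @ y\<close>, conjugating \<open>u\<close> by the inverse of
  \<open>x\<close> gives \<open>y @ x\<close>: the axis is read from a vertex further along
  it.\<close>

lemma cyc_rotate: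
  assumes u: "positive_word N u" and i: "i < length u"
  shows "conjg N (winv (take i u)) (cyc N u) = cyc N (rotate i u)"
proof -
  define x y where "x = take i u" and "y = drop i u"
  have u': "u = x @ y" and r: "rotate i u = y @ x"
    using i by (simp_all add: x_def y_def rotate_drop_take)
  have red: "reduced N x" "reduced N (y @ x)" "reduced N y" "reduced N u"
    by (rule positive_subset_reduced[OF u], auto simp: u')+
  have "mult_word (winv x) u = y"
    using mult_assoc[of N "winv x" x y] red mult_word_winv[of N x]
      mult_word_reduced_append[of N x y] u'
    by simp
  then have "conjg N (winv x) {u} = {y @ x}"
    using red mult_word_reduced_append[of N y x] by (simp add: conjg_eq)
  then show ?thesis
    using conjg_generate[of N "winv x" "{u}"] red by (simp add: r x_def[symmetric])
qed

text \<open>If \<open>p\<close> runs along the axis in its last letter, that letter can be removed at the cost of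
  rotating \<open>u\<close> by one step.\<close>
lemma coset_rep_admissible:
  assumes u: "positive_word N u" and "reduced N p" "i < length u"
  shows "\<exists>q j h. (q, j) \<in> params N u \<and> h \<in> cyc N u \<and>
    mult_word p (winv (take i u)) = mult_word (mult_word q (winv (take j u))) h"
  using assms(2,3)
proof (induction p arbitrary: i rule: rev_induct)
  case Nil
  have "mult_word (mult_word [] (winv (take i u))) [] = mult_word [] (winv (take i u))"
    using mult_word_reduced_append[of N "winv (take i u)" "[]"]
      positive_subset_reduced[OF u set_take_subset] by simp
  moreover have "[] \<in> cyc N u" using generate.one[of "FN N" "{u}"] by simp
  moreover have "([], i) \<in> params N u" using Nil by (simp add: params_def adm_def)
  ultimately show ?case by metis
next
  case (snoc c p)
  define l where "l = length u"
  define t where "t i = winv (take i u)" for i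
  define H where "H = cyc N u"
  interpret H: subgroup H "FN N" unfolding H_def by (rule subgroup_cyc[OF u])
  have Hred: "reduced N h" if "h \<in> H" for h using that H.subset by auto
  have t_red [simp]: "reduced N (t i)" for i
    unfolding t_def using positive_subset_reduced[OF u set_take_subset] by simp
  have redu: "reduced N u" "reduced N p" "fst c < N"
    using snoc.prems reduced_positive[OF u] by (auto simp: reduced_append)
  have l: "l > 0" using u by (simp add: l_def positive_word_def)
  have uH: "u \<in> H" unfolding H_def by (rule generate.incl) simp
  then have uH': "winv u \<in> H" using H.m_inv_closed[OF uH] redu by (simp add: inv_FN)
  have tl: "t l = winv u" "t 0 = []" by (simp_all add: t_def l_def)
  have up: "mult_word [inv_letter (u ! i)] (t i) = t (Suc i)" if "i < l" for i
  proof -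
    have "t (Suc i) = inv_letter (u ! i) # t i"
      using that by (simp add: t_def l_def take_Suc_conv_app_nth)
    then show ?thesis using cons_red_reduced[of N "inv_letter (u ! i)" "t i"] t_red[of "Suc i"] by simp
  qed
  have down: "mult_word [u ! i] (t (Suc i)) = t i" if "i < l" for i
    using up[OF that] cons_red_cancel[OF t_red, of "u ! i" i] by simp
  \<comment> \<open>Membership in an admissible coset. Since \<open>Q\<close> is stable under right
    multiplication by \<open>H\<close>, the induction may change the exponent of \<open>u\<close>
    freely.\<close>
  define Q where "Q x \<longleftrightarrow> (\<exists>q j h. (q, j) \<in> params N u \<and> h \<in> H \<and>
    x = mult_word (mult_word q (t j)) h)" for x
  have Q_mult: "Q (mult_word x h)" if "Q x" "h \<in> H" for x h
  proof -
    obtain q j h' where q: "(q, j) \<in> params N u" "h' \<in> H" "x = mult_word (mult_word q (t j)) h'"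
      using \<open>Q x\<close> unfolding Q_def by auto
    have "mult_word x h = mult_word (mult_word q (t j)) (mult_word h' h)"
      unfolding q using q(1) Hred[OF q(2)] Hred[OF that(2)]
      by (intro mult_assoc[where N = N]) (auto simp: params_def intro!: reduced_mult)
    then show ?thesis using q H.m_closed[OF q(2) that(2)] unfolding Q_def by auto
  qed
  have IH: "Q (mult_word p (t i))" if "i < l" for i
    using snoc.IH[of i] redu that unfolding Q_def t_def l_def H_def by auto
  \<comment> \<open>The index \<open>l\<close> lies outside the range of rotations, but
    \<open>t l\<close> equals \<open>winv u\<close> and so represents the same coset as
    \<open>t 0\<close>.\<close>
  have IHl: "Q (mult_word p (t l))"
    using Q_mult[OF IH[OF l] uH'] mult_assoc[of N p "t 0" "winv u"] redu
    by (simp add: tl)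
  have split: "mult_word (p @ [c]) x = mult_word p (mult_word [c] x)" for x
    by (simp add: mult_word_append)
  have i: "i < l" using snoc.prems by (simp add: l_def)
  have hdr: "hd (rotate i u) = u ! i" using i by (simp add: l_def rotate_drop_take hd_drop_conv_nth)
  have "Q (mult_word (p @ [c]) (t i))"
  proof (cases "adm (p @ [c]) (rotate i u)")
    case True
    then have "(p @ [c], i) \<in> params N u" using snoc.prems by (simp add: params_def)
    moreover have "mult_word (mult_word (p @ [c]) (t i)) [] = mult_word (p @ [c]) (t i)"
      using mult_word_reduced_append[of N "mult_word (p @ [c]) (t i)" "[]"]
        reduced_mult[OF snoc.prems(1) t_red] by simp
    ultimately show ?thesis unfolding Q_def using H.one_closed by (auto intro!: exI)
  next
    case False
    \<comment> \<open>The last edge of the path overlaps the forward ray of the axis in the first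
      case and the backward ray in the second. Removing it raises or lowers the rotation index by
      one, modulo \<open>l\<close>.\<close>
    then consider "c = inv_letter (u ! i)" | "c = last (rotate i u)"
      using hdr by (auto simp: adm_def)
    then show ?thesis
    proof cases
      case 1
      then have "mult_word (p @ [c]) (t i) = mult_word p (t (Suc i))"
        using up[OF i] split by simp
      then show ?thesis using IH[of "Suc i"] IHl i by (cases "Suc i = l") auto
    next
      case 2
      show ?thesis
      proof (cases i)
        case 0
        then have c: "c = u ! (l - 1)" using 2 l by (simp add: last_conv_nth l_def)
        have "mult_word (t l) u = t 0" using redu mult_word_winv by (simp add: tl)
        then have "mult_word [c] (t i) = mult_word [c] (mult_word (t l) u)" using 0 by simp
        also have "\<dots> = mult_word (mult_word [c] (t l)) u"
          using redu mult_assoc[of N "[c]" "t l" u] by simp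
        also have "mult_word [c] (t l) = t (l - 1)" using down[of "l - 1"] l c by simp
        finally have "mult_word (p @ [c]) (t i) = mult_word (mult_word p (t (l - 1))) u"
          using split mult_assoc[of N p "t (l - 1)" u] redu by simp
        then show ?thesis using Q_mult[OF IH[of "l - 1"] uH] l by simp
      next
        case (Suc k)
        have "rotate i u = drop i u @ take i u" using i by (simp add: l_def rotate_drop_take)
        then have "last (rotate i u) = last (take i u)" using Suc i l by (auto simp: l_def)
        also have "\<dots> = u ! k" using Suc i by (simp add: l_def take_Suc_conv_app_nth)
        finally have "mult_word (p @ [c]) (t i) = mult_word p (t k)"
          using split down[of k] i Suc 2 by simp
        then show ?thesis using IH[of k] i Suc by simp
      qed
    qed
  qed
  then show ?case unfolding Q_def t_def H_def .
qed

lemma carrier_rep_admissible: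
  assumes u: "positive_word N u" and g: "reduced N g"
  obtains p i h where "(p, i) \<in> params N u" "h \<in> cyc N u" "g = mult_word (mult_word p (winv (take i u))) h"
proof -
  have "0 < length u" using u by (simp add: positive_word_def)
  moreover have "mult_word g (winv (take 0 u)) = g"
    using mult_word_reduced_append[of N g "[]"] g by simp
  ultimately show ?thesis using coset_rep_admissible[OF u g, of 0] that by metis
qed

text \<open>The factor \<open>h\<close> normalises the cyclic group and the inverted prefix of
  \<open>u\<close> rotates its generator, so only the path \<open>p\<close> is left as a
  conjugator.\<close>

lemma conjg_rep:
  assumes u: "positive_word N u" and "(p, i) \<in> params N u" "h \<in> cyc N u"
  shows "conjg N (mult_word (mult_word p (winv (take i u))) h) (cyc N u) = conjg N p (cyc N (rotate i u))"
proof -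
  have r: "reduced N p" "i < length u" using assms(2) by (auto simp: params_def)
  have t: "reduced N (winv (take i u))"
    using positive_subset_reduced[OF u set_take_subset] by simp
  have h: "reduced N h" using assms(3) cyc_subset[OF u] by auto
  show ?thesis
    using conjg_mult[of N "mult_word p (winv (take i u))" h "cyc N u"] r t h cyc_subset[OF u]
      reduced_mult[OF r(1) t] conjg_subgroup_self[OF subgroup_cyc[OF u] assms(3)]
      conjg_mult[of N p "winv (take i u)" "cyc N u"] cyc_rotate[OF u r(2)]
    by simp
qed

lemma limset_rep:
  assumes u: "positive_word N u" and "(p, i) \<in> params N u"
  shows "limset N (conjg N p (cyc N (rotate i u))) = line p (rotate i u)"
  using assms limset_conj_cyc[OF positive_rotate[OF u]] by (simp add: params_def)

lemma line_rep_inj: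
  assumes u: "simple_word N u" and "(p, i) \<in> params N u" "(q, j) \<in> params N u"
    and eq: "line p (rotate i u) = line q (rotate j u)"
  shows "p = q" "i = j"
proof -
  have pos: "positive_word N (rotate k u)" for k using u positive_rotate by (simp add: simple_word_def)
  show "p = q" by (rule line_inj(1)[OF pos pos eq])
  have "rotate i u = rotate j u"
    by (rule per_inj[OF line_inj(2)[OF pos pos eq]]) simp
  then show "i = j" using assms(1-3) by (auto simp: simple_word_def params_def inj_on_def)
qed

text \<open>Injectivity is read off from the limit sets, which determine path and rotation;
  surjectivity comes from the admissible coset representatives.\<close>

lemma bij_params_conjugates:
  assumes u: "simple_word N u"
  shows "bij_betw (\<lambda>(p, i). conjg N p (cyc N (rotate i u))) (params N u)
    {conjg N g (cyc N u) | g. g \<in> carrier (FN N)}"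
proof (rule bij_betw_imageI)
  have pos: "positive_word N u" using u by (simp add: simple_word_def)
  show "inj_on (\<lambda>(p, i). conjg N p (cyc N (rotate i u))) (params N u)"
    using line_rep_inj[OF u] limset_rep[OF pos] by (auto simp: inj_on_def) metis+
  show "(\<lambda>(p, i). conjg N p (cyc N (rotate i u))) ` params N u =
    {conjg N g (cyc N u) | g. g \<in> carrier (FN N)}"
  proof (intro equalityI subsetI)
    fix x assume "x \<in> (\<lambda>(p, i). conjg N p (cyc N (rotate i u))) ` params N u"
    then obtain p i where pi: "(p, i) \<in> params N u" "x = conjg N p (cyc N (rotate i u))" by auto
    have one: "[] \<in> cyc N u" using generate.one[of "FN N" "{u}"] by simp
    have "reduced N (mult_word (mult_word p (winv (take i u))) [])"
      using pi positive_subset_reduced[OF pos set_take_subset]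
      by (auto simp: params_def intro!: reduced_mult)
    then show "x \<in> {conjg N g (cyc N u) | g. g \<in> carrier (FN N)}"
      using conjg_rep[OF pos pi(1) one] pi(2) by auto
  next
    fix x assume "x \<in> {conjg N g (cyc N u) | g. g \<in> carrier (FN N)}"
    then obtain g where g: "reduced N g" "x = conjg N g (cyc N u)" by auto
    obtain p i h where "(p, i) \<in> params N u" "h \<in> cyc N u" "g = mult_word (mult_word p (winv (take i u))) h"
      using carrier_rep_admissible[OF pos g(1)] .
    then show "x \<in> (\<lambda>(p, i). conjg N p (cyc N (rotate i u))) ` params N u"
      using conjg_rep[OF pos] g(2) by force
  qed
qed

section \<open>Indices and commensurators of cyclic subgroups\<close>

lemma rcosets_self: "subgroup H (FN N) \<Longrightarrow> rcosets\<^bsub>(FN N)\<lparr>carrier := H\<rparr>\<^esub> H = {H}"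
proof -
  assume H: "subgroup H (FN N)"
  interpret K: group "(FN N)\<lparr>carrier := H\<rparr>" by (rule FN.subgroup_imp_group[OF H])
  have "subgroup H ((FN N)\<lparr>carrier := H\<rparr>)" using K.subgroup_self by simp
  then have "H #>\<^bsub>(FN N)\<lparr>carrier := H\<rparr>\<^esub> h = H" if "h \<in> H" for h
    using K.coset_join2[of h H] that by simp
  then show ?thesis using subgroup.one_closed[OF H] by (auto simp: RCOSETS_def)
qed

lemma finite_rcosets_trivial:
  assumes H: "subgroup H (FN N)" and "finite (rcosets\<^bsub>(FN N)\<lparr>carrier := H\<rparr>\<^esub> {[]})"
  shows "finite H"
proof -
  have "rcosets\<^bsub>(FN N)\<lparr>carrier := H\<rparr>\<^esub> {[]} = (\<lambda>h. {h}) ` H"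
    by (auto simp: RCOSETS_def r_coset_def)
  then show ?thesis using assms(2) finite_imageD[of "\<lambda>h. {h}" H] by simp
qed

lemma infinite_cyc:
  assumes "positive_word N u"
  shows "infinite (cyc N u)"
proof -
  have "inj (wpow u)"
  proof (rule injI)
    fix j k assume "wpow u j = wpow u k"
    then have "j * length u = k * length u" by (metis length_wpow)
    then show "j = k" using assms by (simp add: positive_word_def)
  qed
  then have "infinite (range (wpow u))" by (rule range_inj_infinite)
  then show ?thesis using cyc_positive[OF assms] by simp
qed

lemma limset_mono: "H \<subseteq> K \<Longrightarrow> limset N H \<subseteq> limset N K"
  unfolding limset_def by blast

lemma adm_Nil [simp]: "adm [] v"
  by (simp add: adm_def)

lemma doubleton_subset_eq: "{a, b} \<subseteq> {c, d} \<Longrightarrow> a \<noteq> b \<Longrightarrow> {a, b} = {c, d}"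
  by auto

text \<open>Cyclic subgroups with nontrivial intersection have the same limit set, and the limit set
  determines the coset.\<close>
lemma commensurable_conj_eq:
  assumes u: "simple_word N u" and g: "reduced N g" and x: "x \<in> cyc N u \<inter> conjg N g (cyc N u)" "x \<noteq> []"
  shows "g \<in> cyc N u"
proof -
  define H where "H = cyc N u"
  have pos: "positive_word N u" using u by (simp add: simple_word_def)
  interpret H: subgroup H "FN N" unfolding H_def by (rule subgroup_cyc[OF pos])
  obtain p i h where pi: "(p, i) \<in> params N u" "h \<in> H"
    and g_eq: "g = mult_word (mult_word p (winv (take i u))) h"
    using carrier_rep_admissible[OF pos g] unfolding H_def .
  have K: "conjg N g H = conjg N p (cyc N (rotate i u))"
    using conjg_rep[OF pos pi(1)] pi(2) g_eq unfolding H_def by simp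
  then have lK: "limset N (conjg N g H) = line p (rotate i u)" using limset_rep[OF pos pi(1)] by simp
  have lH: "limset N H = line [] u"
    using limset_conj_cyc[OF pos, of "[]"] conjg_Nil[OF cyc_subset[OF pos]] by (simp add: H_def)
  have "{u} \<subseteq> carrier (FN N)" using reduced_positive[OF pos] by simp
  then have sub: "subgroup (conjg N g H) (FN N)"
    unfolding H_def conjg_generate[OF g \<open>{u} \<subseteq> carrier (FN N)\<close>]
    by (intro FN.generate_is_subgroup conjg_subset[OF g])
  have "x \<in> range (wpow u) \<union> range (wpow (winv u))"
    using x(1) unfolding cyc_positive[OF pos] by (rule IntD1)
  then obtain k where k: "x = wpow u k \<or> x = wpow (winv u) k" by blast
  then have k0: "k > 0" using x(2) by (metis gr0I wpow_0)
  \<comment> \<open>The common element may be a negative power, while the description of limit sets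
    is available for positive words; hence \<open>y\<close> is \<open>x\<close> or its
    inverse.\<close>
  define y where "y = wpow u k"
  have ypos: "positive_word N y" unfolding y_def by (rule positive_wpow[OF pos k0])
  have y_mem: "y \<in> K" if "subgroup K (FN N)" "x \<in> K" for K
  proof (cases "x = y")
    case False
    then have "x = winv y" using k by (simp add: y_def winv_wpow)
    then have "inv\<^bsub>FN N\<^esub> x = y" using inv_FN[of N "winv y"] reduced_positive[OF ypos] by simp
    then show ?thesis using subgroup.m_inv_closed[OF that] by simp
  qed (use that in simp)
  have two: "prep [] (per y) \<noteq> prep [] (per (winv y))" by (rule line_two_points[OF ypos])
  have line_eq: "line [] y = line q w" if "line [] y \<subseteq> line q w" for q w
    using that two unfolding line_def by (rule doubleton_subset_eq)
  have ly: "limset N (cyc N y) = line [] y"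
    using limset_conj_cyc[OF ypos, of "[]"] conjg_Nil[OF cyc_subset[OF ypos]] by simp
  have yH: "cyc N y \<subseteq> H"
    using y_mem[OF H.subgroup_axioms] x(1) FN.generate_subgroup_incl[OF _ H.subgroup_axioms, of "{y}"]
    by (simp add: H_def)
  have yK: "cyc N y \<subseteq> conjg N g H"
    using y_mem[OF sub] x(1) FN.generate_subgroup_incl[OF _ sub, of "{y}"] by (simp add: H_def)
  have "line [] y = line [] u"
    using limset_mono[OF yH, of N] unfolding ly lH by (rule line_eq)
  moreover have "line [] y = line p (rotate i u)"
    using limset_mono[OF yK, of N] unfolding ly lK by (rule line_eq)
  ultimately have eq: "line p (rotate i u) = line [] (rotate 0 u)" by simp
  \<comment> \<open>The axis of \<open>u\<close> itself has the parameters \<open>([], 0)\<close>.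
    As both groups share it, injectivity of the parametrisation leaves only \<open>h\<close> in the
    factorisation of \<open>g\<close>.\<close>
  have param0: "([], 0) \<in> params N u" using pos by (simp add: params_def positive_word_def)
  have "p = []" "i = 0" by (rule line_rep_inj[OF u pi(1) param0 eq])+
  then show ?thesis using g_eq pi(2) by (simp add: H_def)
qed

text \<open>A subgroup of finite index in an infinite group is nontrivial, so a commensurating
  element gives two conjugates with nontrivial intersection and lies in the group.\<close>

lemma commens_cyc:
  assumes u: "simple_word N u"
  shows "commens N (cyc N u) = cyc N u"
proof -
  have pos: "positive_word N u" using u by (simp add: simple_word_def)
  note sub = subgroup_cyc[OF pos]
  show ?thesis
  proof (intro equalityI subsetI)
    fix g assume g: "g \<in> commens N (cyc N u)"
    then have red: "reduced N g" by (simp add: commens_def)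
    have "finite (rcosets\<^bsub>(FN N)\<lparr>carrier := cyc N u\<rparr>\<^esub> (cyc N u \<inter> conjg N g (cyc N u)))"
      using g by (simp add: commens_def fin_index_def)
    then have "cyc N u \<inter> conjg N g (cyc N u) \<noteq> {[]}"
      using finite_rcosets_trivial[OF sub] infinite_cyc[OF pos] by metis
    moreover have "[] \<in> cyc N u \<inter> conjg N g (cyc N u)"
    proof -
      have one: "[] \<in> cyc N u" using generate.one[of "FN N" "{u}"] by simp
      moreover have "mult_word (mult_word g []) (winv g) = []"
        using mult_word_reduced_append[of N g "[]"] mult_word_winv[of N "winv g"] red by simp
      ultimately have "[] \<in> conjg N g (cyc N u)"
        unfolding conjg_eq[OF red] by (metis image_eqI)
      then show ?thesis using one by blast
    qed
    ultimately obtain x where "x \<in> cyc N u \<inter> conjg N g (cyc N u)" "x \<noteq> []" by blast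
    then show "g \<in> cyc N u" using commensurable_conj_eq[OF u red] by blast
  next
    fix g assume g: "g \<in> cyc N u"
    have "reduced N g" using g cyc_subset[OF pos] by auto
    then show "g \<in> commens N (cyc N u)"
      using rcosets_self[OF sub]
      by (simp add: commens_def fin_index_def conjg_subgroup_self[OF sub g])
  qed
qed

lemma index_self: "subgroup H (FN N) \<Longrightarrow> index N H H = 1"
  by (simp add: index_def rcosets_self)

section \<open>The boundary and the space of closed subsets\<close>

lemma cyl_Nil [simp]: "cyl N [] = bdry N"
  by (simp add: cyl_def)

lemma cyl_subset: "cyl N w \<subseteq> bdry N"
  by (auto simp: cyl_def)

lemma topspace_bdry_top [simp]: "topspace (bdry_top N) = bdry N"
  unfolding bdry_top_def topology_generated_by_topspace using cyl_subset cyl_Nil by blast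

lemma openin_cyl: "openin (bdry_top N) (cyl N w)"
  unfolding bdry_top_def by (rule topology_generated_by_Basis) simp

text \<open>Replaces the generated topology by agreement of prefixes: a finite intersection takes
  the maximum of the prefix lengths, and conversely a prefix of \<open>x\<close> gives a cylinder
  around \<open>x\<close>.\<close>

lemma openin_bdry_iff:
  "openin (bdry_top N) U \<longleftrightarrow> U \<subseteq> bdry N \<and>
     (\<forall>x\<in>U. \<exists>k. \<forall>y\<in>bdry N. (\<forall>i<k. y i = x i) \<longrightarrow> y \<in> U)" (is "_ \<longleftrightarrow> ?R U")
proof
  assume U: "openin (bdry_top N) U"
  have "\<forall>x\<in>U. \<exists>k. \<forall>y\<in>bdry N. (\<forall>i<k. y i = x i) \<longrightarrow> y \<in> U"
    using U unfolding bdry_top_def openin_topology_generated_by_iff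
  proof induction
    case (Int A B)
    show ?case
    proof
      fix x assume x: "x \<in> A \<inter> B"
      obtain k where k: "\<forall>y\<in>bdry N. (\<forall>i<k. y i = x i) \<longrightarrow> y \<in> A" using Int x by blast
      obtain l where l: "\<forall>y\<in>bdry N. (\<forall>i<l. y i = x i) \<longrightarrow> y \<in> B" using Int x by blast
      show "\<exists>k. \<forall>y\<in>bdry N. (\<forall>i<k. y i = x i) \<longrightarrow> y \<in> A \<inter> B"
        using k l by (intro exI[of _ "max k l"]) auto
    qed
  next
    case (UN K)
    then show ?case by (meson UnionE UnionI)
  next
    case (Basis S)
    then obtain w where S: "S = cyl N w" by auto
    show ?case
    proof
      fix x assume "x \<in> S"
      then show "\<exists>k. \<forall>y\<in>bdry N. (\<forall>i<k. y i = x i) \<longrightarrow> y \<in> S"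
        unfolding S cyl_def by (intro exI[of _ "length w"]) simp
    qed
  qed simp
  then show "?R U" using openin_subset[OF U] by simp
next
  assume R: "?R U"
  show "openin (bdry_top N) U"
  proof (subst openin_subopen, intro ballI)
    fix x assume x: "x \<in> U"
    then obtain k where k: "\<forall>y\<in>bdry N. (\<forall>i<k. y i = x i) \<longrightarrow> y \<in> U" using R by blast
    show "\<exists>T. openin (bdry_top N) T \<and> x \<in> T \<and> T \<subseteq> U"
      using k x R openin_cyl[of N "map x [0..<k]"]
      by (intro exI[of _ "cyl N (map x [0..<k])"]) (auto simp: cyl_def)
  qed
qed

lemma openin_bdryE:
  assumes "openin (bdry_top N) U" "x \<in> U"
  obtains k where "\<And>y. y \<in> bdry N \<Longrightarrow> \<forall>i<k. y i = x i \<Longrightarrow> y \<in> U"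
  using assms unfolding openin_bdry_iff by blast

text \<open>Since \<open>x\<close> is any sequence of letters, this covers complements of cylinders
  and, after a union over \<open>k\<close>, complements of points.\<close>

lemma openin_differ: "openin (bdry_top N) {y \<in> bdry N. \<exists>i<k. y i \<noteq> x i}"
  unfolding openin_bdry_iff
proof (intro conjI ballI)
  fix z assume "z \<in> {y \<in> bdry N. \<exists>i<k. y i \<noteq> x i}"
  then obtain i where "i < k" "z i \<noteq> x i" by blast
  then show "\<exists>k'. \<forall>y\<in>bdry N. (\<forall>i<k'. y i = z i) \<longrightarrow> y \<in> {y \<in> bdry N. \<exists>i<k. y i \<noteq> x i}"
    by (intro exI[of _ k]) auto
qed blast

lemma closedin_cyl: "closedin (bdry_top N) (cyl N w)"
proof -
  have "bdry N - cyl N w = {y \<in> bdry N. \<exists>i<length w. y i \<noteq> w ! i}" by (auto simp: cyl_def)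
  then show ?thesis using openin_differ[of N "length w" "(!) w"] cyl_subset by (simp add: closedin_def)
qed

lemma closedin_bdry_point:
  assumes "x \<in> bdry N"
  shows "closedin (bdry_top N) {x}"
proof -
  have "bdry N - {x} = (\<Union>k. {y \<in> bdry N. \<exists>i<k. y i \<noteq> x i})" by (auto simp: fun_eq_iff)
  then show ?thesis using assms openin_differ[of N _ x] by (auto simp: closedin_def)
qed

lemma doubleton_CN: "x \<in> bdry N \<Longrightarrow> y \<in> bdry N \<Longrightarrow> x \<noteq> y \<Longrightarrow> {x, y} \<in> CN N"
  using closedin_Un[OF closedin_bdry_point[of x N] closedin_bdry_point[of y N]]
  by (auto simp: CN_def insert_commute)

lemma CN_subset_bdry: "A \<in> CN N \<Longrightarrow> A \<subseteq> bdry N"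
  using closedin_subset by (fastforce simp: CN_def)

text \<open>Koenig's lemma: only finitely many letters are available, so a cylinder without finite
  subcover has a one-letter extension without one. The resulting branch converges to a boundary
  point, and the member of the cover around that point contains a whole cylinder of the
  branch.\<close>

lemma compactin_cyl: "compactin (bdry_top N) (cyl N w)"
proof (rule ccontr)
  assume "\<not> compactin (bdry_top N) (cyl N w)"
  then obtain \<U> where op: "\<And>U. U \<in> \<U> \<Longrightarrow> openin (bdry_top N) U" and cov: "cyl N w \<subseteq> \<Union>\<U>"
    and nofin: "\<nexists>\<F>. finite \<F> \<and> \<F> \<subseteq> \<U> \<and> cyl N w \<subseteq> \<Union>\<F>"
    unfolding compactin_def using cyl_subset[of N w] by auto
  define bad where "bad v \<longleftrightarrow> (\<nexists>\<F>. finite \<F> \<and> \<F> \<subseteq> \<U> \<and> cyl N v \<subseteq> \<Union>\<F>)" for v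
  have step: "\<exists>c. bad (v @ [c])" if "bad v" for v
  proof (rule ccontr)
    assume "\<nexists>c. bad (v @ [c])"
    then obtain F where F: "\<And>c. finite (F c) \<and> F c \<subseteq> \<U> \<and> cyl N (v @ [c]) \<subseteq> \<Union>(F c)"
      unfolding bad_def by metis
    define L where "L = {..<N} \<times> (UNIV :: bool set)"
    have "cyl N v \<subseteq> (\<Union>c\<in>L. cyl N (v @ [c]))"
    proof
      fix x assume x: "x \<in> cyl N v"
      then have "x (length v) \<in> L" by (auto simp: cyl_def bdry_def L_def mem_Times_iff)
      moreover have "x \<in> cyl N (v @ [x (length v)])"
        using x by (auto simp: cyl_def nth_append less_Suc_eq)
      ultimately show "x \<in> (\<Union>c\<in>L. cyl N (v @ [c]))" by blast
    qed
    also have "\<dots> \<subseteq> (\<Union>c\<in>L. \<Union>(F c))" by (rule UN_mono) (use F in auto)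
    also have "\<dots> = \<Union>(\<Union>c\<in>L. F c)" by auto
    finally have "cyl N v \<subseteq> \<Union>(\<Union>c\<in>L. F c)" .
    moreover have "finite (\<Union>c\<in>L. F c)" using F by (auto simp: L_def)
    moreover have "(\<Union>c\<in>L. F c) \<subseteq> \<U>" using F by blast
    ultimately show False using that unfolding bad_def by blast
  qed
  define s where "s = rec_nat w (\<lambda>_ v. v @ [SOME c. bad (v @ [c])])"
  have s0: "s 0 = w" and sS: "s (Suc n) = s n @ [SOME c. bad (s n @ [c])]" for n
    by (simp_all add: s_def)
  have bad: "bad (s n)" for n
  proof (induction n)
    case 0
    then show ?case using nofin by (simp add: s0 bad_def)
  next
    case (Suc n)
    then show ?case unfolding sS using someI_ex[OF step] by blast
  qed
  have len: "length (s n) = length w + n" for n by (induction n) (simp_all add: s0 sS)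
  have pre: "s (n + k) ! i = s n ! i" if "i < length (s n)" for n k i
    using that by (induction k) (auto simp: sS nth_append len)
  define \<xi> where "\<xi> i = s (Suc i) ! i" for i
  have \<xi>: "s n ! i = \<xi> i" if "i < length (s n)" for n i
  proof -
    have "s (n + Suc i) ! i = s n ! i" using pre[OF that] by blast
    moreover have "s (Suc i + n) ! i = s (Suc i) ! i" by (rule pre) (simp add: len)
    ultimately show ?thesis by (simp add: \<xi>_def add.commute)
  qed
  have "\<xi> \<in> bdry N"
  proof -
    have "fst (\<xi> i) < N \<and> \<xi> (Suc i) \<noteq> inv_letter (\<xi> i)" for i
    proof -
      \<comment> \<open>A bad cylinder is nonempty, as otherwise the empty family would cover it.
        Any ray in it shows that the first \<open>i + 2\<close> letters of \<xi> form a reduced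
        word.\<close>
      have "cyl N (s (i + 2)) \<noteq> {}"
        using bad[of "i + 2"] unfolding bad_def by (metis empty_subsetI finite.emptyI)
      then obtain z where z: "z \<in> bdry N" "\<And>j. j < length (s (i + 2)) \<Longrightarrow> z j = s (i + 2) ! j"
        by (auto simp: cyl_def)
      have "z i = \<xi> i" "z (Suc i) = \<xi> (Suc i)"
        using z(2)[of i] z(2)[of "Suc i"] \<xi>[of i "i + 2"] \<xi>[of "Suc i" "i + 2"] by (simp_all add: len)
      then show ?thesis using z(1) unfolding bdry_def by (metis (mono_tags, lifting) mem_Collect_eq)
    qed
    then show ?thesis by (simp add: bdry_def)
  qed
  moreover from this have "\<xi> \<in> cyl N w"
    using \<xi>[of _ 0] by (auto simp: cyl_def s0)
  ultimately obtain U where U: "U \<in> \<U>" "\<xi> \<in> U" using cov by blast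
  obtain k where k: "\<forall>y\<in>bdry N. (\<forall>i<k. y i = \<xi> i) \<longrightarrow> y \<in> U"
    using op[OF U(1)] U(2) unfolding openin_bdry_iff by blast
  have "cyl N (s k) \<subseteq> U"
  proof
    fix y assume y: "y \<in> cyl N (s k)"
    then have "y i = \<xi> i" if "i < k" for i
      using \<xi>[of i k] that by (auto simp: cyl_def len)
    then show "y \<in> U" using k y by (auto simp: cyl_def)
  qed
  then have "finite {U} \<and> {U} \<subseteq> \<U> \<and> cyl N (s k) \<subseteq> \<Union>{U}" using U by simp
  then show False using bad[of k] unfolding bad_def by blast
qed

section \<open>The Vietoris topology on closed subsets of the boundary\<close>

lemma topspace_CN_top [simp]: "topspace (CN_top N) = CN N"
proof -
  have "CN N = {A \<in> CN N. A \<subseteq> bdry N}" using CN_subset_bdry by blast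
  moreover have "openin (bdry_top N) (bdry N)" using openin_topspace[of "bdry_top N"] by simp
  ultimately have "CN N \<in> {{A \<in> CN N. A \<subseteq> U} | U. openin (bdry_top N) U}" by blast
  then have "CN N \<subseteq> topspace (CN_top N)"
    unfolding CN_top_def topology_generated_by_topspace by (intro Union_upper UnI1)
  moreover have "topspace (CN_top N) \<subseteq> CN N"
    unfolding CN_top_def topology_generated_by_topspace by (intro Union_least) auto
  ultimately show ?thesis by (rule equalityI[rotated])
qed

lemma openin_CN_subset: "openin (bdry_top N) U \<Longrightarrow> openin (CN_top N) {A \<in> CN N. A \<subseteq> U}"
  unfolding CN_top_def by (rule topology_generated_by_Basis) blast

lemma openin_CN_hit: "openin (bdry_top N) U \<Longrightarrow> openin (CN_top N) {A \<in> CN N. A \<inter> U \<noteq> {}}"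
  unfolding CN_top_def by (rule topology_generated_by_Basis) blast

text \<open>For disjoint cylinders this set is open, closed and compact, so its indicator is an
  admissible test function.\<close>

definition hit2 :: "nat \<Rightarrow> word \<Rightarrow> word \<Rightarrow> bpoint set set" where
  "hit2 N v w = {A \<in> CN N. A \<inter> cyl N v \<noteq> {} \<and> A \<inter> cyl N w \<noteq> {}}"

lemma openin_hit2: "openin (CN_top N) (hit2 N v w)"
proof -
  have "hit2 N v w = {A \<in> CN N. A \<inter> cyl N v \<noteq> {}} \<inter> {A \<in> CN N. A \<inter> cyl N w \<noteq> {}}"
    by (auto simp: hit2_def)
  then show ?thesis by (simp only: openin_Int openin_CN_hit openin_cyl)
qed

lemma closedin_hit2: "closedin (CN_top N) (hit2 N v w)"
proof -
  have op: "openin (bdry_top N) (bdry N - cyl N w)" for w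
    using closedin_cyl[of N w] by (simp add: closedin_def)
  have "CN N - hit2 N v w = {A \<in> CN N. A \<subseteq> bdry N - cyl N v} \<union> {A \<in> CN N. A \<subseteq> bdry N - cyl N w}"
    using CN_subset_bdry by (auto simp: hit2_def)
  then have "openin (CN_top N) (CN N - hit2 N v w)"
    by (simp only: openin_Un openin_CN_subset op)
  then show ?thesis by (auto simp: closedin_def hit2_def)
qed

text \<open>Every member of \<open>CN N\<close> has two points, so the open sets \<open>V m\<close>
  exhaust the space; they increase with \<open>m\<close>, so a compact set lies in one of them.
  Geometrically, the axes in a compact set pass within bounded distance of the base point.\<close>

lemma compactin_CN_split:
  assumes "compactin (CN_top N) K"
  shows "\<exists>m. \<forall>A\<in>K. \<exists>x\<in>A. \<exists>y\<in>A. \<exists>i<m. x i \<noteq> y i"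
proof -
  define V where "V m = {A \<in> CN N. \<exists>x\<in>A. \<exists>y\<in>A. \<exists>i<m. x i \<noteq> y i}" for m :: nat
  have "openin (CN_top N) (V m)" for m
  proof (subst openin_subopen, intro ballI)
    fix A assume A: "A \<in> V m"
    then obtain x y i where xy: "A \<in> CN N" "x \<in> A" "y \<in> A" "i < m" "x i \<noteq> y i" by (auto simp: V_def)
    define r where "r z = map z [0..<Suc i]" for z :: bpoint
    have "A \<in> hit2 N (r x) (r y)"
    proof -
      have "x \<in> cyl N (r x)" "y \<in> cyl N (r y)"
        using xy CN_subset_bdry by (auto simp: cyl_def r_def simp del: upt_Suc)
      then show ?thesis using xy by (auto simp: hit2_def)
    qed
    moreover have "hit2 N (r x) (r y) \<subseteq> V m"
    proof
      fix B assume B: "B \<in> hit2 N (r x) (r y)"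
      then obtain x' y' where "B \<in> CN N" "x' \<in> B" "y' \<in> B" "x' \<in> cyl N (r x)" "y' \<in> cyl N (r y)"
        by (auto simp: hit2_def)
      moreover from this have "x' i = x i" "y' i = y i"
        by (auto simp: cyl_def r_def simp del: upt_Suc)
      ultimately show "B \<in> V m" using xy by (auto simp: V_def) metis
    qed
    ultimately show "\<exists>T. openin (CN_top N) T \<and> A \<in> T \<and> T \<subseteq> V m" using openin_hit2 by blast
  qed
  moreover have "K \<subseteq> \<Union>(range V)"
  proof
    fix A assume "A \<in> K"
    then have "A \<in> CN N" using compactin_subset_topspace[OF assms] by auto
    moreover from this obtain x y i where "x \<in> A" "y \<in> A" "x i \<noteq> y i"
      unfolding CN_def by (auto simp: fun_eq_iff)
    ultimately have "A \<in> V (Suc i)" unfolding V_def by blast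
    then show "A \<in> \<Union>(range V)" by blast
  qed
  ultimately obtain F where F: "finite F" "F \<subseteq> range V" "K \<subseteq> \<Union>F"
    using assms unfolding compactin_def by (metis (no_types, lifting) imageE)
  then obtain M where M: "finite M" "F = V ` M" by (meson finite_subset_image)
  have "\<exists>x\<in>A. \<exists>y\<in>A. \<exists>i<Max (insert 0 M). x i \<noteq> y i" if "A \<in> K" for A
  proof -
    obtain m where m: "m \<in> M" "A \<in> V m" using F(3) M(2) \<open>A \<in> K\<close> by blast
    moreover have "m \<le> Max (insert 0 M)" using M(1) m(1) by simp
    ultimately show ?thesis unfolding V_def by simp (meson order.strict_trans2)
  qed
  then show ?thesis by blast
qed

text \<open>Two-point sets with close ends are close in the Vietoris topology. This is the form in
  which the axes of rotated words approach the axis of \<open>a\<close>.\<close>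

lemma openin_CN_doubleton_nbhd:
  assumes "openin (CN_top N) W" "{x, y} \<in> W"
  shows "\<exists>k. \<forall>x'\<in>bdry N. \<forall>y'\<in>bdry N. x' \<noteq> y' \<longrightarrow> (\<forall>i<k. x' i = x i \<and> y' i = y i) \<longrightarrow> {x', y'} \<in> W"
  using assms unfolding CN_top_def openin_topology_generated_by_iff
proof induction
  case (Int A B)
  obtain k where k: "\<forall>x'\<in>bdry N. \<forall>y'\<in>bdry N. x' \<noteq> y' \<longrightarrow> (\<forall>i<k. x' i = x i \<and> y' i = y i) \<longrightarrow> {x', y'} \<in> A"
    using Int.IH(1) Int.prems by blast
  obtain l where l: "\<forall>x'\<in>bdry N. \<forall>y'\<in>bdry N. x' \<noteq> y' \<longrightarrow> (\<forall>i<l. x' i = x i \<and> y' i = y i) \<longrightarrow> {x', y'} \<in> B"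
    using Int.IH(2) Int.prems by blast
  from k l show ?case by (intro exI[of _ "max k l"]) auto
next
  case (UN K)
  then obtain A where A: "A \<in> K" "{x, y} \<in> A" by blast
  show ?case using UN.IH[OF A] A(1) by (meson UnionI)
next
  case (Basis S)
  then consider U where "openin (bdry_top N) U" "S = {A \<in> CN N. A \<subseteq> U}"
    | U where "openin (bdry_top N) U" "S = {A \<in> CN N. A \<inter> U \<noteq> {}}" by blast
  then show ?case
  proof cases
    case 1
    then have "x \<in> U" "y \<in> U" using Basis.prems by auto
    obtain k where k: "\<And>z. z \<in> bdry N \<Longrightarrow> \<forall>i<k. z i = x i \<Longrightarrow> z \<in> U"
      using openin_bdryE[OF 1(1) \<open>x \<in> U\<close>] by blast
    obtain l where l: "\<And>z. z \<in> bdry N \<Longrightarrow> \<forall>i<l. z i = y i \<Longrightarrow> z \<in> U"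
      using openin_bdryE[OF 1(1) \<open>y \<in> U\<close>] by blast
    have "{x', y'} \<in> S" if "x' \<in> bdry N" "y' \<in> bdry N" "x' \<noteq> y'"
      "\<forall>i<max k l. x' i = x i \<and> y' i = y i" for x' y'
      unfolding 1(2) using doubleton_CN[OF that(1-3)] k[OF that(1)] l[OF that(2)] that(4) by simp
    then show ?thesis by blast
  next
    case 2
    then consider "x \<in> U" | "y \<in> U" using Basis.prems by auto
    then show ?thesis
    proof cases
      case 1
      obtain k where k: "\<And>z. z \<in> bdry N \<Longrightarrow> \<forall>i<k. z i = x i \<Longrightarrow> z \<in> U"
        using openin_bdryE[OF 2(1) \<open>x \<in> U\<close>] by blast
      have "{x', y'} \<in> S" if "x' \<in> bdry N" "y' \<in> bdry N" "x' \<noteq> y'"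
        "\<forall>i<k. x' i = x i \<and> y' i = y i" for x' y'
        unfolding 2(2) using doubleton_CN[OF that(1-3)] k[OF that(1)] that(4) by simp
      then show ?thesis by blast
    next
      case y: 2
      obtain k where k: "\<And>z. z \<in> bdry N \<Longrightarrow> \<forall>i<k. z i = y i \<Longrightarrow> z \<in> U"
        using openin_bdryE[OF 2(1) \<open>y \<in> U\<close>] by blast
      have "{x', y'} \<in> S" if "x' \<in> bdry N" "y' \<in> bdry N" "x' \<noteq> y'"
        "\<forall>i<k. x' i = x i \<and> y' i = y i" for x' y'
        unfolding 2(2) using doubleton_CN[OF that(1-3)] k[OF that(2)] that(4) by simp
      then show ?thesis by blast
    qed
  qed
qed simp

text \<open>Alexander's subbase theorem speaks of the whole space \<open>X\<close>, that is,
  \<open>V\<close> with the subbase restricted to it. Open sets of the generated topology restrict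
  to open sets of \<open>X\<close>, so compactness of \<open>X\<close> carries over to
  \<open>V\<close> as a subset.\<close>

lemma compactin_generated_subbase:
  assumes sub: "V \<subseteq> \<Union>\<B>"
    and fin: "\<And>C. C \<subseteq> \<B> \<Longrightarrow> V \<subseteq> \<Union>C \<Longrightarrow> \<exists>C'. finite C' \<and> C' \<subseteq> C \<and> V \<subseteq> \<Union>C'"
  shows "compactin (topology_generated_by \<B>) V"
proof -
  define X where "X = topology (arbitrary union_of (finite intersection_of (\<lambda>x. x \<in> \<B>) relative_to V))"
  have comp: "compact_space X" by (rule Alexander_subbase_alt[OF sub fin X_def[symmetric]])
  have topX: "topspace X = V" by (simp add: X_def)
  have basis: "openin X (V \<inter> S)" if "S \<in> \<B>" for S
    unfolding X_def openin_subbase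
    by (intro arbitrary_union_of_inc relative_to_inc finite_intersection_of_inc that)
  have op: "openin X (V \<inter> W)" if "generate_topology_on \<B> W" for W
    using that
  proof induction
    case (Int A B)
    have "V \<inter> (A \<inter> B) = (V \<inter> A) \<inter> (V \<inter> B)" by blast
    then show ?case using Int.IH by (simp only: openin_Int)
  next
    case (UN K)
    have "V \<inter> \<Union>K = \<Union>((\<inter>) V ` K)" by blast
    then show ?case using UN.IH by (simp only: openin_Union image_iff) blast
  qed (auto intro: basis)
  show ?thesis unfolding compactin_def
  proof (intro conjI allI impI)
    show "V \<subseteq> topspace (topology_generated_by \<B>)"
      using sub by (simp only: topology_generated_by_topspace)
    fix \<U> assume \<U>: "Ball \<U> (openin (topology_generated_by \<B>)) \<and> V \<subseteq> \<Union>\<U>"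
    have "\<And>U. U \<in> (\<inter>) V ` \<U> \<Longrightarrow> openin X U"
      using \<U> op by (auto simp: openin_topology_generated_by_iff)
    moreover have "topspace X \<subseteq> \<Union>((\<inter>) V ` \<U>)" using \<U> topX by auto
    ultimately obtain \<F> where \<F>: "finite \<F>" "\<F> \<subseteq> (\<inter>) V ` \<U>" "V \<subseteq> \<Union>\<F>"
      using comp unfolding compact_space_def topX[symmetric] by (metis compactinD)
    then obtain \<G> where "finite \<G>" "\<G> \<subseteq> \<U>" "\<F> = (\<inter>) V ` \<G>" by (meson finite_subset_image)
    then show "\<exists>\<F>. finite \<F> \<and> \<F> \<subseteq> \<U> \<and> V \<subseteq> \<Union>\<F>" using \<F>(3) by (intro exI[of _ \<G>]) auto
  qed
qed

text \<open>For a subbasic cover, let \<open>H\<close> collect the open sets whose hitting sets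
  belong to it, and let \<open>B\<close> be the complement of their union. If \<open>B\<close>
  misses one of the cylinders, compactness of that cylinder is enough. Otherwise \<open>B\<close>
  itself lies in \<open>hit2 N v w\<close> and must be covered, and it is the worst case that
  determines a finite subcover.\<close>

lemma compactin_hit2:
  assumes disj: "cyl N v \<inter> cyl N w = {}"
  shows "compactin (CN_top N) (hit2 N v w)"
  unfolding CN_top_def
proof (rule compactin_generated_subbase)
  define hit where "hit U = {A \<in> CN N. A \<inter> U \<noteq> {}}" for U
  let ?B = "{{A \<in> CN N. A \<subseteq> U} | U. openin (bdry_top N) U} \<union>
      {{A \<in> CN N. A \<inter> U \<noteq> {}} | U. openin (bdry_top N) U}"
  have "hit2 N v w \<subseteq> topspace (CN_top N)" by (auto simp: hit2_def)
  then show "hit2 N v w \<subseteq> \<Union>?B" unfolding CN_top_def topology_generated_by_topspace .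
  fix C assume C: "C \<subseteq> ?B" "hit2 N v w \<subseteq> \<Union>C"
  define H where "H = {U. openin (bdry_top N) U \<and> hit U \<in> C}"
  have fin: "\<exists>C'. finite C' \<and> C' \<subseteq> C \<and> {A \<in> CN N. A \<inter> S \<noteq> {}} \<subseteq> \<Union>C'"
    if S: "compactin (bdry_top N) S" "S \<subseteq> \<Union>H" for S
  proof -
    obtain F where F: "finite F" "F \<subseteq> H" "S \<subseteq> \<Union>F"
      using compactinD[OF S(1), of H] S(2) unfolding H_def by blast
    have "{A \<in> CN N. A \<inter> S \<noteq> {}} \<subseteq> \<Union>(hit ` F)"
      using F(3) unfolding hit_def by blast
    moreover have "hit ` F \<subseteq> C" using F(2) unfolding H_def by blast
    ultimately show ?thesis using F(1) by (intro exI[of _ "hit ` F"]) simp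
  qed
  have hit2_sub: "hit2 N v w \<subseteq> {A \<in> CN N. A \<inter> cyl N v \<noteq> {}}" "hit2 N v w \<subseteq> {A \<in> CN N. A \<inter> cyl N w \<noteq> {}}"
    unfolding hit2_def by blast+
  show "\<exists>C'. finite C' \<and> C' \<subseteq> C \<and> hit2 N v w \<subseteq> \<Union>C'"
  proof (cases "cyl N v \<subseteq> \<Union>H \<or> cyl N w \<subseteq> \<Union>H")
    case True
    then show ?thesis using fin[OF compactin_cyl] hit2_sub by (meson order_trans)
  next
    case False
    define B where "B = bdry N - \<Union>H"
    have "openin (bdry_top N) (\<Union>H)" unfolding H_def by blast
    then have clB: "closedin (bdry_top N) B"
      unfolding B_def using closedin_diff[OF closedin_topspace, of "bdry_top N"] by simp
    obtain x y where xy: "x \<in> cyl N v" "y \<in> cyl N w" "x \<in> B" "y \<in> B"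
      using False cyl_subset unfolding B_def by blast
    then have "x \<noteq> y" using disj by blast
    then have BCN: "B \<in> CN N" using clB xy unfolding CN_def by blast
    then have "B \<in> hit2 N v w" using xy unfolding hit2_def by blast
    then obtain S where S: "S \<in> C" "B \<in> S" using C(2) by blast
    \<comment> \<open>The set covering \<open>B\<close> cannot be a hitting set, because
      \<open>B\<close> avoids every member of \<open>H\<close>. So it consists of the closed sets
      inside some \<open>U\<close>; closed sets not inside \<open>U\<close> meet the compact
      complement of \<open>U\<close>, which \<open>H\<close> covers.\<close>
    have "\<nexists>U. openin (bdry_top N) U \<and> S = hit U"
    proof
      assume "\<exists>U. openin (bdry_top N) U \<and> S = hit U"
      then obtain U where U: "openin (bdry_top N) U" "S = hit U" by blast
      then have "U \<in> H" using S(1) by (simp add: H_def)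
      moreover have "B \<inter> U \<noteq> {}" using S(2) unfolding U hit_def by blast
      ultimately show False unfolding B_def by blast
    qed
    moreover have "S \<in> ?B" using C(1) S(1) by (rule subsetD)
    then have "(\<exists>U. openin (bdry_top N) U \<and> S = {A \<in> CN N. A \<subseteq> U}) \<or>
      (\<exists>U. openin (bdry_top N) U \<and> S = hit U)" unfolding hit_def Un_iff mem_Collect_eq
      by (elim disjE exE conjE)
        (rule disjI1, rule exI, erule conjI, assumption, rule disjI2, rule exI, erule conjI, assumption)
    ultimately obtain U where U: "openin (bdry_top N) U" "S = {A \<in> CN N. A \<subseteq> U}" by metis
    have "closedin (bdry_top N) (bdry N - U)"
      using closedin_diff[OF closedin_topspace U(1)] by simp
    then have "compactin (bdry_top N) (bdry N - U)"
      using closed_compactin[OF compactin_cyl[of N "[]"]] by simp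
    moreover have "B \<subseteq> U" using S(2) unfolding U by simp
    then have "bdry N - U \<subseteq> \<Union>H" unfolding B_def by auto
    ultimately have "\<exists>C'. finite C' \<and> C' \<subseteq> C \<and> {A \<in> CN N. A \<inter> (bdry N - U) \<noteq> {}} \<subseteq> \<Union>C'"
      by (rule fin)
    then obtain C' where C': "finite C'" "C' \<subseteq> C" "{A \<in> CN N. A \<inter> (bdry N - U) \<noteq> {}} \<subseteq> \<Union>C'"
      by (elim exE conjE)
    have "hit2 N v w \<subseteq> \<Union>(insert S C')"
    proof
      fix A assume "A \<in> hit2 N v w"
      then have A: "A \<in> CN N" "A \<subseteq> bdry N" using CN_subset_bdry by (auto simp: hit2_def)
      show "A \<in> \<Union>(insert S C')"
      proof (cases "A \<subseteq> U")
        case True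
        then have "A \<in> S" using A U by simp
        then show ?thesis by simp
      next
        case False
        then have "A \<inter> (bdry N - U) \<noteq> {}" using A(2) by blast
        then show ?thesis using C'(3) A(1) by blast
      qed
    qed
    then show ?thesis using C'(1,2) S(1) by (intro exI[of _ "insert S C'"]) simp
  qed
qed

lemma indicator_hit2_Cc:
  assumes "cyl N v \<inter> cyl N w = {}"
  shows "indicator (hit2 N v w) \<in> Cc N"
proof -
  let ?V = "hit2 N v w"
  have "continuous_map (CN_top N) euclideanreal (indicator ?V)"
    unfolding continuous_map_def
  proof (intro conjI allI impI)
    fix U :: "real set"
    have op: "openin (CN_top N) (CN N - ?V)" using closedin_hit2[of N v w] by (simp add: closedin_def)
    have op2: "openin (CN_top N) (if 1 \<in> U then ?V else {})"
      "openin (CN_top N) (if 0 \<in> U then CN N - ?V else {})"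
      using openin_hit2[of N v w] op by auto
    have "{x \<in> CN N. indicator ?V x \<in> U} = (if 1 \<in> U then ?V else {}) \<union> (if 0 \<in> U then CN N - ?V else {})"
      by (auto simp: indicator_def hit2_def)
    then show "openin (CN_top N) {x \<in> topspace (CN_top N). indicator ?V x \<in> U}"
      unfolding topspace_CN_top using openin_Un[OF op2] by simp
  qed simp
  moreover have "{A \<in> CN N. indicator ?V A \<noteq> (0::real)} = ?V"
    by (auto simp: indicator_def hit2_def)
  moreover have "CN_top N closure_of ?V = ?V"
    by (rule closure_of_closedin[OF closedin_hit2])
  ultimately show ?thesis using compactin_hit2[OF assms] by (simp add: Cc_def)
qed

section \<open>The action on the boundary\<close>

lemma act_simps [simp]: "act [] \<xi> = \<xi>" "act (c # g) \<xi> = act1 c (act g \<xi>)"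
  "act (g @ h) \<xi> = act g (act h \<xi>)"
  by (simp_all add: act_def)

lemma act1_bdry:
  assumes "fst c < N" "\<xi> \<in> bdry N"
  shows "act1 c \<xi> \<in> bdry N"
proof -
  have "\<xi> (Suc i) \<noteq> inv_letter (\<xi> i)" "fst (\<xi> i) < N" for i using assms(2) by (auto simp: bdry_def)
  then show ?thesis using assms(1)
    by (auto simp: bdry_def act1_def gr0_conv_Suc dest: eq_inv_letter_swap[THEN iffD1])
qed

lemma act1_inv:
  assumes "\<xi> \<in> bdry N"
  shows "act1 (inv_letter c) (act1 c \<xi>) = \<xi>"
proof (cases "\<xi> 0 = inv_letter c")
  case True
  moreover have "\<xi> (Suc 0) \<noteq> inv_letter (\<xi> 0)" using assms by (auto simp: bdry_def)
  ultimately show ?thesis by (auto simp: act1_def fun_eq_iff)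
qed (auto simp: act1_def fun_eq_iff)

text \<open>A cancellation shifts the ray one place to the left, which costs one letter of
  agreement.\<close>

lemma act1_agree:
  assumes "\<forall>i<Suc k. x i = y i"
  shows "\<forall>i<k. act1 c x i = act1 c y i"
proof -
  have "x 0 = y 0" using assms by simp
  then show ?thesis using assms by (auto simp: act1_def)
qed

lemma act_bdry: "\<forall>c\<in>set g. fst c < N \<Longrightarrow> \<xi> \<in> bdry N \<Longrightarrow> act g \<xi> \<in> bdry N"
  by (induction g) (auto intro: act1_bdry)

lemma act_winv: "\<forall>c\<in>set g. fst c < N \<Longrightarrow> \<xi> \<in> bdry N \<Longrightarrow> act (winv g) (act g \<xi>) = \<xi>"
proof (induction g)
  case (Cons c g)
  then have "act g \<xi> \<in> bdry N" by (intro act_bdry) auto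
  then show ?case using Cons by (simp add: act1_inv)
qed simp

lemma act_agree: "\<forall>i<k + length g. x i = y i \<Longrightarrow> \<forall>i<k. act g x i = act g y i"
proof (induction g arbitrary: k)
  case (Cons c g)
  then have "\<forall>i<Suc k. act g x i = act g y i" using Cons.IH[of "Suc k"] by simp
  then show ?case using act1_agree by simp
qed simp

lemma openin_act_preimage:
  assumes g: "\<forall>c\<in>set g. fst c < N" and U: "openin (bdry_top N) U"
  shows "openin (bdry_top N) {x \<in> bdry N. act g x \<in> U}"
  unfolding openin_bdry_iff
proof (intro conjI ballI)
  fix x assume x: "x \<in> {x \<in> bdry N. act g x \<in> U}"
  then obtain k where k: "\<And>y. y \<in> bdry N \<Longrightarrow> \<forall>i<k. y i = act g x i \<Longrightarrow> y \<in> U"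
    using openin_bdryE[OF U, of "act g x"] by blast
  have "act g y \<in> U" if "y \<in> bdry N" "\<forall>i<k + length g. y i = x i" for y
    using k[OF act_bdry[OF g that(1)]] act_agree[OF that(2)] by blast
  then show "\<exists>k. \<forall>y\<in>bdry N. (\<forall>i<k. y i = x i) \<longrightarrow> y \<in> {x \<in> bdry N. act g x \<in> U}" by blast
qed blast

text \<open>Writing the image as a preimage under the inverse turns continuity of the action into
  closedness of images.\<close>

lemma act_image_eq:
  assumes g: "\<forall>c\<in>set g. fst c < N" and A: "A \<subseteq> bdry N"
  shows "act g ` A = {x \<in> bdry N. act (winv g) x \<in> A}"
proof (intro equalityI subsetI)
  fix x assume "x \<in> act g ` A"
  then obtain y where "y \<in> A" "x = act g y" by blast
  then show "x \<in> {x \<in> bdry N. act (winv g) x \<in> A}"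
    using A act_bdry[OF g, of y] act_winv[OF g, of y] by auto
next
  fix x assume x: "x \<in> {x \<in> bdry N. act (winv g) x \<in> A}"
  have "\<forall>c\<in>set (winv g). fst c < N" using g by auto
  then have "act g (act (winv g) x) = x" using act_winv[of "winv g" N x] x by simp
  then show "x \<in> act g ` A" using x by (metis (mono_tags, lifting) image_eqI mem_Collect_eq)
qed

lemma act_image_CN:
  assumes g: "\<forall>c\<in>set g. fst c < N" and A: "A \<in> CN N"
  shows "act g ` A \<in> CN N"
proof -
  have sub: "A \<subseteq> bdry N" by (rule CN_subset_bdry[OF A])
  have g': "\<forall>c\<in>set (winv g). fst c < N" using g by auto
  have "openin (bdry_top N) (bdry N - A)" using A by (simp add: CN_def closedin_def)
  from openin_act_preimage[OF g' this]
  have "openin (bdry_top N) {x \<in> bdry N. act (winv g) x \<in> bdry N - A}" .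
  moreover have "{x \<in> bdry N. act (winv g) x \<in> bdry N - A} = bdry N - act g ` A"
    unfolding act_image_eq[OF g sub] using act_bdry[OF g'] by blast
  moreover have "act g ` A \<subseteq> bdry N" using act_bdry[OF g] sub by blast
  ultimately have "closedin (bdry_top N) (act g ` A)" by (simp add: closedin_def)
  moreover obtain x y where xy: "x \<in> A" "y \<in> A" "x \<noteq> y" using A by (auto simp: CN_def)
  then have "act g x \<noteq> act g y" using act_winv[OF g] sub by (metis subsetD)
  ultimately show ?thesis using xy unfolding CN_def by blast
qed

lemma continuous_act_CN:
  assumes g: "\<forall>c\<in>set g. fst c < N"
  shows "continuous_map (CN_top N) (CN_top N) (\<lambda>A. act g ` A)"
proof -
  let ?B = "{{A \<in> CN N. A \<subseteq> U} | U. openin (bdry_top N) U} \<union>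
      {{A \<in> CN N. A \<inter> U \<noteq> {}} | U. openin (bdry_top N) U}"
  have pre: "openin (CN_top N) ((\<lambda>A. act g ` A) -` S \<inter> topspace (CN_top N))" if "S \<in> ?B" for S
  proof -
    consider U where "openin (bdry_top N) U" "S = {A \<in> CN N. A \<subseteq> U}"
      | U where "openin (bdry_top N) U" "S = {A \<in> CN N. A \<inter> U \<noteq> {}}" using \<open>S \<in> _\<close> by blast
    then show ?thesis
    proof cases
      case 1
      have "(\<lambda>A. act g ` A) -` S \<inter> topspace (CN_top N) = {A \<in> CN N. A \<subseteq> {x \<in> bdry N. act g x \<in> U}}"
        unfolding 1(2) using act_image_CN[OF g] CN_subset_bdry by auto
      then show ?thesis using openin_CN_subset[OF openin_act_preimage[OF g 1(1)]] by simp
    next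
      case 2
      have "(\<lambda>A. act g ` A) -` S \<inter> topspace (CN_top N) = {A \<in> CN N. A \<inter> {x \<in> bdry N. act g x \<in> U} \<noteq> {}}"
        unfolding 2(2) using act_image_CN[OF g] CN_subset_bdry by fastforce
      then show ?thesis using openin_CN_hit[OF openin_act_preimage[OF g 2(1)]] by simp
    qed
  qed
  have "(\<lambda>A. act g ` A) ` topspace (CN_top N) \<subseteq> topspace (CN_top N)"
    using act_image_CN[OF g] by auto
  then have "(\<lambda>A. act g ` A) ` topspace (CN_top N) \<subseteq> \<Union>?B"
    by (simp only: CN_top_def topology_generated_by_topspace)
  with pre have "continuous_map (CN_top N) (topology_generated_by ?B) (\<lambda>A. act g ` A)"
    by (rule continuous_on_generated_topo)
  then show ?thesis unfolding CN_top_def[symmetric] .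
qed

section \<open>Measurability of the action and equivariance of limit sets\<close>

lemma space_CN_borel [simp]: "space (CN_borel N) = CN N"
  by (simp add: CN_borel_def space_measure_of_conv)

lemma sets_CN_borel: "sets (CN_borel N) = sigma_sets (CN N) {U. openin (CN_top N) U}"
  unfolding CN_borel_def using openin_subset[of "CN_top N"] by (intro sets_measure_of) auto

lemma openin_sets_CN_borel: "openin (CN_top N) U \<Longrightarrow> U \<in> sets (CN_borel N)"
  unfolding sets_CN_borel by (rule sigma_sets.Basic) simp

lemma measurable_act_CN:
  assumes g: "\<forall>c\<in>set g. fst c < N"
  shows "(\<lambda>A. act g ` A) \<in> measurable (CN_borel N) (CN_borel N)"
proof -
  have "(\<lambda>A. act g ` A) \<in> measurable (CN_borel N) (sigma (CN N) {U. openin (CN_top N) U})"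
  proof (rule measurable_measure_of)
    show "{U. openin (CN_top N) U} \<subseteq> Pow (CN N)" using openin_subset[of "CN_top N"] by auto
    show "(\<lambda>A. act g ` A) \<in> space (CN_borel N) \<rightarrow> CN N" using act_image_CN[OF g] by auto
    fix U assume "U \<in> {U. openin (CN_top N) U}"
    then have "openin (CN_top N) {A \<in> CN N. act g ` A \<in> U}"
      using openin_continuous_map_preimage[OF continuous_act_CN[OF g], of U] by simp
    moreover have "(\<lambda>A. act g ` A) -` U \<inter> space (CN_borel N) = {A \<in> CN N. act g ` A \<in> U}" by auto
    ultimately show "(\<lambda>A. act g ` A) -` U \<inter> space (CN_borel N) \<in> sets (CN_borel N)"
      using openin_sets_CN_borel by simp
  qed
  then show ?thesis by (simp add: CN_borel_def)
qed

lemma mult_word_letter_right: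
  assumes "reduced N w" "fst d < N"
  shows "mult_word w [d] = (if w \<noteq> [] \<and> last w = inv_letter d then butlast w else w @ [d])"
proof (cases "w \<noteq> [] \<and> last w = inv_letter d")
  case True
  then have w: "w = butlast w @ [inv_letter d]" by (metis append_butlast_last_id)
  then have red: "reduced N (butlast w)" using assms reduced_append by metis
  have "mult_word w [d] = mult_word (butlast w) (mult_word [inv_letter d] [d])"
    using w mult_word_append by metis
  also have "\<dots> = butlast w"
    using mult_word_reduced_append[of N "butlast w" "[]"] red by (simp add: cons_red_def)
  finally show ?thesis using True by simp
next
  case False
  then have "reduced N (w @ [d])" using assms by (auto simp: reduced_append)
  then show ?thesis using mult_word_reduced_append False by auto
qed

text \<open>Multiplying by \<open>c\<close> on the left changes a long word as \<open>act1 c\<close>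
  changes the ray; multiplying by the inverse on the right touches only the far end of the word,
  which is invisible in the limit.\<close>

lemma limset_conjg_letter_subset:
  assumes c: "fst c < N" and H: "H \<subseteq> carrier (FN N)" and \<xi>: "\<xi> \<in> limset N H"
  shows "act1 c \<xi> \<in> limset N (conjg N [c] H)"
  unfolding limset_iff
proof (intro conjI allI)
  have bd: "\<xi> \<in> bdry N" using \<xi> by (simp add: limset_iff)
  then show "act1 c \<xi> \<in> bdry N" by (rule act1_bdry[OF c])
  fix n
  \<comment> \<open>Two spare letters, because each of the two multiplications can cancel
    one.\<close>
  obtain h where h: "h \<in> H" "n + 2 \<le> length h" "\<forall>i<n + 2. h ! i = \<xi> i"
    using \<xi> unfolding limset_iff by blast
  have red: "reduced N h" using h(1) H by auto
  define w where "w = cons_red c h"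
  have redw: "reduced N w" unfolding w_def by (rule reduced_cons_red[OF red c])
  have w: "n + 1 \<le> length w \<and> (\<forall>i<n + 1. w ! i = act1 c \<xi> i)"
  proof (cases "\<xi> 0 = inv_letter c")
    case True
    then have "w = tl h" using h(2,3) unfolding w_def by (cases h) (auto simp: cons_red_def)
    then show ?thesis using True h(2,3) by (auto simp: act1_def nth_tl)
  next
    case False
    then have "w = c # h" using h(2,3) unfolding w_def by (cases h) (auto simp: cons_red_def)
    then show ?thesis using False h(2,3) by (auto simp: act1_def nth_Cons')
  qed
  define k where "k = mult_word w [inv_letter c]"
  have "k \<in> conjg N [c] H"
    unfolding k_def w_def using h(1) c by (auto simp: conjg_eq)
  moreover have "n \<le> length k \<and> (\<forall>i<n. k ! i = act1 c \<xi> i)"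
    unfolding k_def mult_word_letter_right[OF redw, of "inv_letter c", simplified, OF c]
    using w by (auto simp: nth_butlast nth_append)
  ultimately show "\<exists>h\<in>conjg N [c] H. n \<le> length h \<and> (\<forall>i<n. h ! i = act1 c \<xi> i)" by blast
qed

lemma limset_conjg_letter:
  assumes c: "fst c < N" and H: "H \<subseteq> carrier (FN N)"
  shows "limset N (conjg N [c] H) = act1 c ` limset N H"
proof (intro equalityI subsetI)
  fix \<xi> assume \<xi>: "\<xi> \<in> limset N (conjg N [c] H)"
  have red: "reduced N [c]" using c by simp
  have "act1 (inv_letter c) \<xi> \<in> limset N (conjg N [inv_letter c] (conjg N [c] H))"
    using c \<xi> by (intro limset_conjg_letter_subset conjg_subset[OF red H]) simp_all
  moreover have "conjg N [inv_letter c] (conjg N [c] H) = H"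
    using conjg_cancel(1)[OF red H] by simp
  moreover have "act1 c (act1 (inv_letter c) \<xi>) = \<xi>"
    using act1_inv[of \<xi> N "inv_letter c"] \<xi> by (simp add: limset_iff)
  ultimately show "\<xi> \<in> act1 c ` limset N H" by (metis image_eqI)
qed (use limset_conjg_letter_subset[OF assms] in blast)

lemma limset_conjg:
  assumes "reduced N g" "H \<subseteq> carrier (FN N)"
  shows "limset N (conjg N g H) = act g ` limset N H"
  using assms(1)
proof (induction g)
  case Nil
  then show ?case using conjg_Nil[OF assms(2)] by simp
next
  case (Cons c g)
  then have g: "reduced N g" "fst c < N" "reduced N [c]" by (auto simp: reduced_Cons)
  have "conjg N (c # g) H = conjg N [c] (conjg N g H)"
    using conjg_mult[OF g(3,1) assms(2)] cons_red_reduced[OF Cons.prems] by simp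
  then show ?case
    using limset_conjg_letter[OF g(2) conjg_subset[OF g(1) assms(2)]] Cons.IH[OF g(1)]
    by (simp add: image_image)
qed

section \<open>Counting currents of cyclic subgroups\<close>

lemma sets_eta [simp]: "sets (eta N H) = sets (CN_borel N)"
proof -
  have "sets (CN_borel N) \<subseteq> Pow (CN N)" using sets.space_closed[of "CN_borel N"] by simp
  moreover have "sigma_sets (CN N) (sets (CN_borel N)) = sets (CN_borel N)"
    using sets.sigma_sets_eq[of "CN_borel N"] by simp
  ultimately show ?thesis by (simp add: eta_def meas_zero_def)
qed

abbreviation conjs :: "nat \<Rightarrow> word \<Rightarrow> word set set" where
  "conjs N u \<equiv> {conjg N g (cyc N u) | g. g \<in> carrier (FN N)}"

lemma cyc_nontrivial: "positive_word N u \<Longrightarrow> cyc N u \<noteq> {[]}"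
  using infinite_cyc by fastforce

lemma line_CN:
  assumes "positive_word N v" "reduced N p" "adm p v"
  shows "line p v \<in> CN N"
  using line_subset_bdry[OF assms] line_two_points[OF assms(1), of p]
  unfolding line_def by (intro doubleton_CN) auto

lemma line_params_CN:
  assumes "positive_word N u" "(p, i) \<in> params N u"
  shows "line p (rotate i u) \<in> CN N"
  using assms by (auto simp: params_def intro!: line_CN positive_rotate)

lemma limset_conjs_CN:
  assumes u: "simple_word N u" and H: "H \<in> conjs N u"
  shows "limset N H \<in> CN N"
proof -
  have pos: "positive_word N u" using u by (simp add: simple_word_def)
  have "H \<in> (\<lambda>(p, i). conjg N p (cyc N (rotate i u))) ` params N u"
    using H unfolding bij_betw_imp_surj_on[OF bij_params_conjugates[OF u]] .
  then obtain p i where "(p, i) \<in> params N u" "H = conjg N p (cyc N (rotate i u))" by auto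
  then show ?thesis using limset_rep[OF pos] line_params_CN[OF pos] by simp
qed

text \<open>The group is its own commensurator, so the index is 1, and a sum of point masses is the
  push-forward of a counting measure. In this form invariance and integrals follow by changes of
  variables.\<close>

lemma eta_cyc:
  assumes u: "simple_word N u"
  shows "eta N (cyc N u) = distr (count_space (conjs N u)) (CN_borel N) (limset N)"
proof -
  have pos: "positive_word N u" using u by (simp add: simple_word_def)
  have idx: "index N (cyc N u) (cyc N u) = 1" by (rule index_self[OF subgroup_cyc[OF pos]])
  have cov: "(\<integral>\<^sup>+ H'. indicator A (limset N H') \<partial>count_space (conjs N u)) =
    emeasure (count_space (conjs N u)) (limset N -` A \<inter> space (count_space (conjs N u)))" for A
  proof -
    have "(\<integral>\<^sup>+ H'. indicator A (limset N H') \<partial>count_space (conjs N u)) =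
      (\<integral>\<^sup>+ H'. indicator (limset N -` A \<inter> conjs N u) H' \<partial>count_space (conjs N u))"
      by (intro nn_integral_cong) (auto simp: indicator_def)
    then show ?thesis by simp
  qed
  have "eta N (cyc N u) = measure_of (CN N) (sets (CN_borel N))
       (\<lambda>A. of_nat (index N (cyc N u) (cyc N u)) *
            (\<integral>\<^sup>+ H'. indicator A (limset N H') \<partial>count_space (conjs N u)))"
    using cyc_nontrivial[OF pos] unfolding eta_def commens_cyc[OF u] by simp
  also have "\<dots> = measure_of (CN N) (sets (CN_borel N))
       (\<lambda>A. emeasure (count_space (conjs N u)) (limset N -` A \<inter> space (count_space (conjs N u))))"
    unfolding idx cov by simp
  also have "\<dots> = distr (count_space (conjs N u)) (CN_borel N) (limset N)"
    by (simp add: distr_def)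
  finally show ?thesis .
qed

lemma eta_cyc_params:
  assumes u: "simple_word N u"
  shows "eta N (cyc N u) =
    distr (count_space (params N u)) (CN_borel N) (\<lambda>(p, i). line p (rotate i u))"
proof -
  have pos: "positive_word N u" using u by (simp add: simple_word_def)
  let ?\<Phi> = "\<lambda>(p, i). conjg N p (cyc N (rotate i u))"
  note bij = bij_params_conjugates[OF u]
  have \<Phi>: "?\<Phi> \<in> params N u \<rightarrow> conjs N u" using bij_betwE[OF bij] by (intro Pi_I) (rule bspec)
  have "eta N (cyc N u) = distr (distr (count_space (params N u)) (count_space (conjs N u)) ?\<Phi>)
      (CN_borel N) (limset N)"
    unfolding distr_bij_count_space[OF bij] by (rule eta_cyc[OF u])
  also have "\<dots> = distr (count_space (params N u)) (CN_borel N) (limset N \<circ> ?\<Phi>)"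
    using limset_conjs_CN[OF u] \<Phi> by (intro distr_distr) auto
  also have "\<dots> = distr (count_space (params N u)) (CN_borel N) (\<lambda>(p, i). line p (rotate i u))"
    using limset_rep[OF pos] by (intro distr_cong) auto
  finally show ?thesis .
qed

lemma bij_conjg_conjs:
  assumes pos: "positive_word N u" and g: "reduced N g"
  shows "bij_betw (conjg N g) (conjs N u) (conjs N u)"
proof (rule bij_betwI[where g = "conjg N (winv g)"])
  have closed: "conjg N h H \<in> conjs N u" if h: "reduced N h" and H: "H \<in> conjs N u" for h H
  proof -
    obtain k where k: "reduced N k" "H = conjg N k (cyc N u)" using H by auto
    have "conjg N h H = conjg N (mult_word h k) (cyc N u)"
      unfolding k using conjg_mult[OF h k(1) cyc_subset[OF pos]] by simp
    then show ?thesis using reduced_mult[OF h k(1)] by auto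
  qed
  then show "conjg N g \<in> conjs N u \<rightarrow> conjs N u" "conjg N (winv g) \<in> conjs N u \<rightarrow> conjs N u"
    using g by auto
  have sub: "H \<subseteq> carrier (FN N)" if "H \<in> conjs N u" for H
    using that conjg_subset[OF _ cyc_subset[OF pos]] by auto
  show "conjg N (winv g) (conjg N g H) = H" if "H \<in> conjs N u" for H
    by (rule conjg_cancel(1)[OF g sub[OF that]])
  show "conjg N g (conjg N (winv g) H) = H" if "H \<in> conjs N u" for H
    by (rule conjg_cancel(2)[OF g sub[OF that]])
qed

text \<open>Conjugation by \<open>g\<close> permutes the conjugates and \<open>limset\<close>
  intertwines it with the action of \<open>g\<close>, so the push-forward of the counting measure
  does not change.\<close>

lemma eta_cyc_invariant:
  assumes u: "simple_word N u" and g: "reduced N g"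
  shows "distr (eta N (cyc N u)) (eta N (cyc N u)) (\<lambda>A. act g ` A) = eta N (cyc N u)"
proof -
  have pos: "positive_word N u" using u by (simp add: simple_word_def)
  let ?C = "count_space (conjs N u)"
  have lim: "limset N \<in> measurable ?C (CN_borel N)"
    using limset_conjs_CN[OF u] by auto
  have gl: "\<forall>c\<in>set g. fst c < N" using g reduced_letter by blast
  note bij = bij_conjg_conjs[OF pos g]
  have cg: "conjg N g \<in> measurable ?C ?C" using bij_betwE[OF bij] by auto
  have sub: "H \<subseteq> carrier (FN N)" if "H \<in> conjs N u" for H
    using that conjg_subset[OF _ cyc_subset[OF pos]] by auto
  have "distr (eta N (cyc N u)) (eta N (cyc N u)) (\<lambda>A. act g ` A) =
    distr (distr ?C (CN_borel N) (limset N)) (CN_borel N) (\<lambda>A. act g ` A)"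
    by (intro distr_cong eta_cyc[OF u]) auto
  also have "\<dots> = distr ?C (CN_borel N) ((\<lambda>A. act g ` A) \<circ> limset N)"
    by (rule distr_distr[OF measurable_act_CN[OF gl] lim])
  also have "\<dots> = distr ?C (CN_borel N) (limset N \<circ> conjg N g)"
    using limset_conjg[OF g sub] by (intro distr_cong) auto
  also have "\<dots> = distr (distr ?C ?C (conjg N g)) (CN_borel N) (limset N)"
    by (rule distr_distr[OF lim cg, symmetric])
  also have "\<dots> = eta N (cyc N u)" unfolding distr_bij_count_space[OF bij] eta_cyc[OF u] ..
  finally show ?thesis .
qed

lemma finite_short_words: "finite {p. reduced N p \<and> length p < m}"
proof -
  have "{p. reduced N p \<and> length p < m} \<subseteq> {p. set p \<subseteq> {..<N} \<times> UNIV \<and> length p \<le> m}"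
    by (auto simp: mem_Times_iff dest: reduced_letter)
  then show ?thesis using finite_lists_length_le[of "{..<N} \<times> (UNIV :: bool set)" m]
    by (auto intro: finite_subset)
qed

lemma line_split_short:
  assumes "\<exists>x\<in>line p v. \<exists>y\<in>line p v. \<exists>i<m. x i \<noteq> y i"
  shows "length p < m"
proof (rule ccontr)
  assume "\<not> length p < m"
  then have "x i = y i" if "x \<in> line p v" "y \<in> line p v" "i < m" for x y i
    using that by (auto simp: line_def prep_def)
  then show False using assms by blast
qed

text \<open>A compact set contains only lines whose rays separate within a fixed depth
  \<open>m\<close>. Their paths are shorter than \<open>m\<close>, hence finite in number.\<close>

lemma eta_cyc_SCurr:
  assumes u: "simple_word N u"
  shows "eta N (cyc N u) \<in> SCurr N"
proof -
  have pos: "positive_word N u" using u by (simp add: simple_word_def)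
  have "emeasure (eta N (cyc N u)) K < \<infinity>" if K: "compactin (CN_top N) K" for K
  proof (cases "K \<in> sets (CN_borel N)")
    \<comment> \<open>\<open>SCurr\<close> asks for a bound on every compact set; outside the
      sigma-algebra \<open>emeasure\<close> has the default value 0.\<close>
    case False
    then show ?thesis by (simp add: emeasure_notin_sets)
  next
    case True
    obtain m where m: "\<And>A. A \<in> K \<Longrightarrow> \<exists>x\<in>A. \<exists>y\<in>A. \<exists>i<m. x i \<noteq> y i"
      using compactin_CN_split[OF K] by blast
    let ?L = "\<lambda>(p, i). line p (rotate i u)"
    have "?L -` K \<inter> params N u \<subseteq> {p. reduced N p \<and> length p < m} \<times> {..<length u}"
      using line_split_short[OF m] by (auto simp: params_def)
    then have fin: "finite (?L -` K \<inter> params N u)"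
      by (rule finite_subset) (simp add: finite_short_words)
    have "?L \<in> measurable (count_space (params N u)) (CN_borel N)"
      using line_params_CN[OF pos] by auto
    then have "emeasure (eta N (cyc N u)) K = emeasure (count_space (params N u)) (?L -` K \<inter> params N u)"
      unfolding eta_cyc_params[OF u] using True by (simp add: emeasure_distr)
    then show ?thesis using fin by (simp add: emeasure_count_space_finite of_nat_less_top)
  qed
  then show ?thesis using eta_cyc_invariant[OF u] by (simp add: SCurr_def)
qed

section \<open>Test functions and their integrals against the cyclic currents\<close>

lemma Cc_measurable:
  assumes f: "f \<in> Cc N"
  shows "f \<in> borel_measurable (CN_borel N)"
proof (rule borel_measurableI)
  fix S :: "real set" assume "open S"
  then have "openin (CN_top N) {A \<in> CN N. f A \<in> S}"
    using openin_continuous_map_preimage[of "CN_top N" euclideanreal f S] f by (simp add: Cc_def)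
  moreover have "f -` S \<inter> space (CN_borel N) = {A \<in> CN N. f A \<in> S}" by auto
  ultimately show "f -` S \<inter> space (CN_borel N) \<in> sets (CN_borel N)"
    using openin_sets_CN_borel by simp
qed

lemma Cc_support:
  assumes f: "f \<in> Cc N"
  obtains m where "\<And>A. A \<in> CN N \<Longrightarrow> f A \<noteq> 0 \<Longrightarrow> \<exists>x\<in>A. \<exists>y\<in>A. \<exists>i<m. x i \<noteq> y i"
proof -
  let ?S = "{A \<in> CN N. f A \<noteq> 0}"
  obtain m where m: "\<forall>A\<in>CN_top N closure_of ?S. \<exists>x\<in>A. \<exists>y\<in>A. \<exists>i<m. x i \<noteq> y i"
    using compactin_CN_split[of N "CN_top N closure_of ?S"] f by (auto simp: Cc_def)
  have "?S \<subseteq> CN_top N closure_of ?S" by (rule closure_of_subset) auto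
  then show ?thesis using m that by blast
qed

lemma Cc_bounded:
  assumes f: "f \<in> Cc N"
  obtains B where "\<And>A. A \<in> CN N \<Longrightarrow> \<bar>f A\<bar> \<le> B"
proof -
  let ?S = "{A \<in> CN N. f A \<noteq> 0}"
  have "compactin euclideanreal (f ` (CN_top N closure_of ?S))"
    using f by (intro image_compactin[of "CN_top N"]) (auto simp: Cc_def)
  then have "bounded (f ` (CN_top N closure_of ?S))"
    by (simp add: compact_imp_bounded)
  then obtain B where B: "\<And>A. A \<in> CN_top N closure_of ?S \<Longrightarrow> \<bar>f A\<bar> \<le> B"
    by (auto simp: bounded_iff)
  have sub: "?S \<subseteq> CN_top N closure_of ?S" by (rule closure_of_subset) auto
  \<comment> \<open>\<open>B\<close> bounds the values on the support only. If the support is empty,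
    \<open>B\<close> may be negative, whence the maximum with 0.\<close>
  have "\<bar>f A\<bar> \<le> max B 0" if "A \<in> CN N" for A
  proof (cases "f A = 0")
    case False
    then have "A \<in> CN_top N closure_of ?S" using that sub by blast
    then show ?thesis using B by fastforce
  qed simp
  then show ?thesis by (rule that)
qed

text \<open>Extended by 0 to pairs that are not admissible, so that the sums range over a product in
  which the set of paths is independent of the word.\<close>

definition line_val :: "(bpoint set \<Rightarrow> real) \<Rightarrow> word \<Rightarrow> word \<Rightarrow> real" where
  "line_val f p v = (if adm p v then f (line p v) else 0)"

text \<open>The bound \<open>m\<close> comes from \<open>f\<close> alone. With the same finite set
  of paths for every \<open>u\<close>, a limit over varying words can be taken path by path.\<close>

lemma integral_eta_cyc:
  assumes u: "simple_word N u" and f: "f \<in> Cc N"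
    and m: "\<And>A. A \<in> CN N \<Longrightarrow> f A \<noteq> 0 \<Longrightarrow> \<exists>x\<in>A. \<exists>y\<in>A. \<exists>i<m. x i \<noteq> y i"
  shows "(\<integral>A. f A \<partial>eta N (cyc N u)) =
    (\<Sum>p | reduced N p \<and> length p < m. \<Sum>i<length u. line_val f p (rotate i u))"
proof -
  have pos: "positive_word N u" using u by (simp add: simple_word_def)
  let ?L = "\<lambda>(p, i). line p (rotate i u)"
  let ?R = "{p. reduced N p \<and> length p < m} \<times> {..<length u}"
  have L: "?L \<in> measurable (count_space (params N u)) (CN_borel N)"
    using line_params_CN[OF pos] by auto
  have sub: "{x \<in> params N u. f (?L x) \<noteq> 0} \<subseteq> ?R"
  proof
    fix x assume x: "x \<in> {x \<in> params N u. f (?L x) \<noteq> 0}"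
    obtain p i where pi: "x = (p, i)" by (cases x)
    then have P: "(p, i) \<in> params N u" "f (line p (rotate i u)) \<noteq> 0" using x by auto
    then have "length p < m"
      using line_split_short[OF m[OF line_params_CN[OF pos P(1)] P(2)]] by simp
    then show "x \<in> ?R" using P(1) by (simp add: pi params_def)
  qed
  have finR: "finite ?R" using finite_short_words by simp
  have "(\<integral>A. f A \<partial>eta N (cyc N u)) = (\<integral>x. f (?L x) \<partial>count_space (params N u))"
    unfolding eta_cyc_params[OF u] by (rule integral_distr[OF L Cc_measurable[OF f]])
  also have "\<dots> = (\<Sum>x | x \<in> params N u \<and> f (?L x) \<noteq> 0. f (?L x))"
    by (rule lebesgue_integral_count_space_finite_support) (rule finite_subset[OF sub finR])
  also have "\<dots> = (\<Sum>(p, i)\<in>?R. line_val f p (rotate i u))"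
    using sub by (intro sum.mono_neutral_cong_left[OF finR])
      (auto simp: line_val_def params_def split: if_splits)
  also have "\<dots> = (\<Sum>p | reduced N p \<and> length p < m. \<Sum>i<length u. line_val f p (rotate i u))"
    by (rule sum.cartesian_product[symmetric])
  finally show ?thesis .
qed

section \<open>Scalings and sums of currents\<close>

lemma meas_scale_eq:
  assumes "sets \<mu> = sets (CN_borel N)"
  shows "meas_scale N c \<mu> = scale_measure (ennreal c) \<mu>"
  using assms sets_eq_imp_space_eq[OF assms] by (simp add: meas_scale_def scale_measure_def)

lemma meas_scale_SCurr:
  assumes \<mu>: "\<mu> \<in> SCurr N"
  shows "meas_scale N c \<mu> \<in> SCurr N"
proof -
  have s: "sets \<mu> = sets (CN_borel N)" using \<mu> by (simp add: SCurr_def)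
  have sp: "space \<mu> = CN N" using sets_eq_imp_space_eq[OF s] by simp
  let ?\<nu> = "scale_measure (ennreal c) \<mu>"
  have inv: "distr ?\<nu> ?\<nu> (\<lambda>A. act g ` A) = ?\<nu>" if g: "reduced N g" for g
  proof -
    have gl: "\<forall>c\<in>set g. fst c < N" using g reduced_letter by blast
    have meas: "(\<lambda>A. act g ` A) \<in> measurable \<mu> \<mu>" "(\<lambda>A. act g ` A) \<in> measurable ?\<nu> ?\<nu>"
      using measurable_act_CN[OF gl] measurable_cong_sets[of \<mu> "CN_borel N" \<mu> "CN_borel N"]
        measurable_cong_sets[of ?\<nu> "CN_borel N" ?\<nu> "CN_borel N"] s by auto
    have inv\<mu>: "distr \<mu> \<mu> (\<lambda>A. act g ` A) = \<mu>" using \<mu> g by (simp add: SCurr_def)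
    show ?thesis
    proof (rule measure_eqI)
      fix X assume "X \<in> sets (distr ?\<nu> ?\<nu> (\<lambda>A. act g ` A))"
      then have X: "X \<in> sets \<mu>" by simp
      have "emeasure (distr ?\<nu> ?\<nu> (\<lambda>A. act g ` A)) X = ennreal c * emeasure (distr \<mu> \<mu> (\<lambda>A. act g ` A)) X"
        using X meas by (simp add: emeasure_distr space_scale_measure)
      then show "emeasure (distr ?\<nu> ?\<nu> (\<lambda>A. act g ` A)) X = emeasure ?\<nu> X" by (simp add: inv\<mu>)
    qed simp
  qed
  have "emeasure ?\<nu> K < \<infinity>" if "compactin (CN_top N) K" for K
    using \<mu> that by (auto simp: SCurr_def ennreal_mult_less_top)
  then show ?thesis unfolding meas_scale_eq[OF s] using inv s by (simp add: SCurr_def)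
qed

lemma integral_meas_scale:
  assumes s: "sets \<mu> = sets (CN_borel N)" and c: "c \<ge> 0" and f: "f \<in> Cc N"
  shows "(\<integral>A. f A \<partial>meas_scale N c \<mu>) = c * (\<integral>A. f A \<partial>\<mu>)"
proof -
  have fm: "f \<in> borel_measurable \<mu>"
    using Cc_measurable[OF f] measurable_cong_sets[OF s refl] by auto
  have "scale_measure (ennreal c) \<mu> = density \<mu> (\<lambda>_. ennreal c)"
    by (rule measure_eqI) (simp_all add: emeasure_density_const)
  then have "(\<integral>A. f A \<partial>meas_scale N c \<mu>) = (\<integral>A. c *\<^sub>R f A \<partial>\<mu>)"
    unfolding meas_scale_eq[OF s] using fm c by (simp add: integral_density)
  then show ?thesis by simp
qed

lemma sets_meas_sum [simp]: "sets (meas_sum N I \<mu>) = sets (CN_borel N)"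
  and space_meas_sum [simp]: "space (meas_sum N I \<mu>) = CN N"
proof -
  have "sets (CN_borel N) \<subseteq> Pow (CN N)" using sets.space_closed[of "CN_borel N"] by simp
  moreover have "sigma_sets (CN N) (sets (CN_borel N)) = sets (CN_borel N)"
    using sets.sigma_sets_eq[of "CN_borel N"] by simp
  ultimately show "sets (meas_sum N I \<mu>) = sets (CN_borel N)" "space (meas_sum N I \<mu>) = CN N"
    by (simp_all add: meas_sum_def)
qed

text \<open>The values prescribed to \<open>measure_of\<close> are available once countable
  additivity is shown; it amounts to exchanging a series with the integral over the counting
  measure.\<close>

lemma emeasure_meas_sum:
  assumes \<mu>: "\<And>i. i \<in> I \<Longrightarrow> sets (\<mu> i) = sets (CN_borel N)" and A: "A \<in> sets (CN_borel N)"
  shows "emeasure (meas_sum N I \<mu>) A = (\<integral>\<^sup>+ i. emeasure (\<mu> i) A \<partial>count_space I)"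
proof -
  have "countably_additive (sets (CN_borel N)) (\<lambda>A. \<integral>\<^sup>+ i. emeasure (\<mu> i) A \<partial>count_space I)"
  proof (rule countably_additiveI)
    fix F :: "nat \<Rightarrow> bpoint set set"
    assume F: "range F \<subseteq> sets (CN_borel N)" "disjoint_family F"
    have "(\<Sum>n. \<integral>\<^sup>+ i. emeasure (\<mu> i) (F n) \<partial>count_space I) =
      (\<integral>\<^sup>+ i. (\<Sum>n. emeasure (\<mu> i) (F n)) \<partial>count_space I)"
      by (rule nn_integral_suminf[symmetric]) simp
    also have "\<dots> = (\<integral>\<^sup>+ i. emeasure (\<mu> i) (\<Union>n. F n) \<partial>count_space I)"
      using F \<mu> by (intro nn_integral_cong suminf_emeasure) auto
    finally show "(\<Sum>n. \<integral>\<^sup>+ i. emeasure (\<mu> i) (F n) \<partial>count_space I) =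
      (\<integral>\<^sup>+ i. emeasure (\<mu> i) (\<Union>n. F n) \<partial>count_space I)" .
  qed
  moreover have "positive (sets (CN_borel N)) (\<lambda>A. \<integral>\<^sup>+ i. emeasure (\<mu> i) A \<partial>count_space I)"
    by (simp add: positive_def)
  ultimately show ?thesis
    using emeasure_measure_of[OF meas_sum_def, of N I \<mu> A] sets.space_closed[of "CN_borel N"] A
    by simp
qed

lemma emeasure_meas_zero: "emeasure (meas_zero N) A = 0"
  by (simp add: meas_zero_def emeasure_sigma)

lemma integral_null:
  assumes "emeasure M (space M) = 0"
  shows "(\<integral>x. f x \<partial>M) = (0::real)"
proof (rule integral_eq_zero_AE)
  show "AE x in M. f x = 0" by (rule AE_I[OF _ assms]) auto
qed

section \<open>Convergence of the rescaled currents of \<open>a\<^sup>n b\<close>\<close>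

text \<open>The subbasic open sets each restrict a single integral, and eventual membership passes
  to finite intersections and unions.\<close>

lemma limitin_SCurr_top:
  assumes \<mu>: "\<And>n. \<mu> n \<in> SCurr N" and \<nu>: "\<nu> \<in> SCurr N"
    and lim: "\<And>f. f \<in> Cc N \<Longrightarrow> (\<lambda>n. \<integral>A. f A \<partial>\<mu> n) \<longlonglongrightarrow> (\<integral>A. f A \<partial>\<nu>)"
  shows "limitin (SCurr_top N) \<mu> \<nu> sequentially"
proof -
  have ev: "\<forall>\<^sub>F n in sequentially. \<mu> n \<in> U" if "openin (SCurr_top N) U" "\<nu> \<in> U" for U
    using that unfolding SCurr_top_def openin_topology_generated_by_iff
  proof induction
    case (Int A B)
    then have "\<forall>\<^sub>F n in sequentially. \<mu> n \<in> A" "\<forall>\<^sub>F n in sequentially. \<mu> n \<in> B" by simp_all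
    then show ?case by eventually_elim simp
  next
    case (UN K)
    then obtain A where A: "A \<in> K" "\<nu> \<in> A" by blast
    from UN.IH[OF this] show ?case by eventually_elim (use A in blast)
  next
    case (Basis S)
    then obtain f U where S: "S = {\<mu> \<in> SCurr N. (\<integral>A. f A \<partial>\<mu>) \<in> U}" "f \<in> Cc N" "open U"
      by blast
    then have "(\<integral>A. f A \<partial>\<nu>) \<in> U" using Basis.prems by simp
    then have "\<forall>\<^sub>F n in sequentially. (\<integral>A. f A \<partial>\<mu> n) \<in> U"
      using topological_tendstoD[OF lim[OF S(2)] S(3)] by simp
    then show ?case by eventually_elim (simp add: S \<mu>)
  qed simp
  \<comment> \<open>The topspace is the union of the subbase. The zero function with target
    \<open>UNIV\<close> shows that it contains every current.\<close>
  have "(\<lambda>_. 0) \<in> Cc N" by (simp add: Cc_def)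
  then have "{\<mu> \<in> SCurr N. (\<integral>A. (0::real) \<partial>\<mu>) \<in> UNIV} \<subseteq> topspace (SCurr_top N)"
    unfolding SCurr_top_def topology_generated_by_topspace by (intro Union_upper) blast
  then have "\<nu> \<in> topspace (SCurr_top N)" using \<nu> by auto
  then show ?thesis using ev by (simp add: limitin_def)
qed

text \<open>A Cesaro argument: all terms but at most \<open>k\<close> at each end are close to
  \<open>T\<close>, and the exceptional ones are bounded, so division by \<open>n + 1\<close> makes
  them negligible.\<close>

lemma average_tendsto:
  fixes F :: "nat \<Rightarrow> nat \<Rightarrow> real"
  assumes B: "\<And>n i. i \<le> n \<Longrightarrow> \<bar>F n i\<bar> \<le> B"
    and T: "\<And>\<epsilon>. \<epsilon> > 0 \<Longrightarrow> \<exists>k. \<forall>n i. k \<le> i \<longrightarrow> i + k \<le> n \<longrightarrow> \<bar>F n i - T\<bar> < \<epsilon>"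
  shows "(\<lambda>n. (\<Sum>i\<le>n. F n i) / real (Suc n)) \<longlonglongrightarrow> T"
proof (rule LIMSEQ_I)
  fix \<epsilon> :: real assume \<epsilon>: "\<epsilon> > 0"
  obtain k where k: "\<And>n i. k \<le> i \<Longrightarrow> i + k \<le> n \<Longrightarrow> \<bar>F n i - T\<bar> < \<epsilon> / 2"
    using T[of "\<epsilon> / 2"] \<epsilon> by auto
  define C where "C = B + \<bar>T\<bar>"
  have C: "C \<ge> 0" using B[of 0 0] by (simp add: C_def)
  \<comment> \<open>Chosen so that the exceptional indices, at most \<open>2 * k\<close> with
    deviation at most \<open>C\<close>, contribute less than \<open>\<epsilon> / 2\<close> to the
    average.\<close>
  obtain n0 :: nat where n0: "real n0 > 2 * (real (2 * k) * C) / \<epsilon>" using reals_Archimedean2 by blast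
  have "\<bar>(\<Sum>i\<le>n. F n i) / real (Suc n) - T\<bar> < \<epsilon>" if n: "n \<ge> n0" for n
  proof -
    define E where "E = {i. i \<le> n \<and> (i < k \<or> n < i + k)}"
    have "E \<subseteq> {..<k} \<union> {n + 1 - k..<n + 1}" unfolding E_def by auto
    then have "card E \<le> card ({..<k} \<union> {n + 1 - k..<n + 1})" by (intro card_mono) auto
    also have "\<dots> \<le> card {..<k} + card {n + 1 - k..<n + 1}" by (rule card_Un_le)
    also have "\<dots> \<le> 2 * k" by simp
    finally have cE: "real (card E) \<le> real (2 * k)" by simp
    have "(\<Sum>i\<le>n. F n i) - real (Suc n) * T = (\<Sum>i\<le>n. F n i - T)" by (simp add: sum_subtractf)
    then have "\<bar>(\<Sum>i\<le>n. F n i) - real (Suc n) * T\<bar> \<le> (\<Sum>i\<le>n. \<bar>F n i - T\<bar>)"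
      by (simp add: sum_abs)
    also have "\<dots> \<le> (\<Sum>i\<le>n. \<epsilon> / 2 + (if i \<in> E then C else 0))"
    proof (rule sum_mono)
      fix i assume "i \<in> {..n}"
      then have i: "i \<le> n" by simp
      show "\<bar>F n i - T\<bar> \<le> \<epsilon> / 2 + (if i \<in> E then C else 0)"
      proof (cases "i \<in> E")
        case True
        have "\<bar>F n i - T\<bar> \<le> C" using B[OF i] unfolding C_def by linarith
        then show ?thesis using True \<epsilon> by simp
      next
        case False
        then have "k \<le> i" "i + k \<le> n" using i by (auto simp: E_def)
        then show ?thesis using k[of i n] False by simp
      qed
    qed
    also have "\<dots> = real (Suc n) * (\<epsilon> / 2) + (\<Sum>i\<le>n. if i \<in> E then C else 0)"
      by (simp add: sum.distrib)
    also have "(\<Sum>i\<le>n. if i \<in> E then C else 0) = real (card E) * C"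
    proof -
      have "(\<Sum>i\<le>n. if i \<in> E then C else 0) = (\<Sum>i\<in>{..n} \<inter> E. C)"
        by (rule sum.inter_restrict[symmetric]) simp
      moreover have "{..n} \<inter> E = E" by (auto simp: E_def)
      ultimately show ?thesis by simp
    qed
    also have "real (card E) * C \<le> real (2 * k) * C" by (rule mult_right_mono[OF cE C])
    finally have le: "\<bar>(\<Sum>i\<le>n. F n i) - real (Suc n) * T\<bar> \<le> real (Suc n) * (\<epsilon> / 2) + real (2 * k) * C"
      by simp
    have "2 * (real (2 * k) * C) / \<epsilon> < real (Suc n)" using n0 n by linarith
    then have "real (2 * k) * C < real (Suc n) * (\<epsilon> / 2)" using \<epsilon> by (simp add: field_simps)
    with le have lt: "\<bar>(\<Sum>i\<le>n. F n i) - real (Suc n) * T\<bar> < real (Suc n) * \<epsilon>" by linarith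
    have "(\<Sum>i\<le>n. F n i) / real (Suc n) - T = ((\<Sum>i\<le>n. F n i) - real (Suc n) * T) / real (Suc n)"
      by (simp add: diff_divide_distrib del: of_nat_Suc)
    then have "\<bar>(\<Sum>i\<le>n. F n i) / real (Suc n) - T\<bar> = \<bar>(\<Sum>i\<le>n. F n i) - real (Suc n) * T\<bar> / real (Suc n)"
      by (simp del: of_nat_Suc)
    also have "\<dots> < \<epsilon>" using lt by (subst pos_divide_less_eq) (simp_all add: mult.commute del: of_nat_Suc)
    finally show ?thesis .
  qed
  then show "\<exists>n0. \<forall>n\<ge>n0. norm ((\<Sum>i\<le>n. F n i) / real (Suc n) - T) < \<epsilon>" by auto
qed

section \<open>The words \<open>anb n\<close> and their axes\<close>

abbreviation la :: letter where "la \<equiv> (0, False)"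
abbreviation lb :: letter where "lb \<equiv> (Suc 0, False)"

definition anb :: "nat \<Rightarrow> word" where
  "anb n = replicate n la @ [lb]"

lemma length_anb [simp]: "length (anb n) = Suc n"
  by (simp add: anb_def)

lemma rotate_anb:
  assumes "i \<le> n"
  shows "rotate i (anb n) = replicate (n - i) la @ [lb] @ replicate i la"
  using assms by (simp add: rotate_drop_take anb_def)

lemma simple_word_anb:
  assumes "N \<ge> 2"
  shows "simple_word N (anb n)"
  unfolding simple_word_def
proof
  show "positive_word N (anb n)" using assms by (auto simp: positive_word_def anb_def)
  \<comment> \<open>The number of leading letters \<open>la\<close> recovers the rotation
    index.\<close>
  have "length (takeWhile ((=) la) (rotate i (anb n))) = n - i" if "i \<le> n" for i
    unfolding rotate_anb[OF that] by (subst takeWhile_append2) auto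
  then show "inj_on (\<lambda>i. rotate i (anb n)) {..<length (anb n)}"
    by (intro inj_onI) (metis diff_diff_cancel length_anb lessThan_iff less_Suc_eq_le)
qed

lemma simple_word_la: "N \<ge> 2 \<Longrightarrow> simple_word N [la]"
  by (auto simp: simple_word_def positive_word_def inj_on_def)

lemma per_single: "per [c] i = c"
  by (simp add: per_def)

lemma per_append_replicate: "j < m \<Longrightarrow> per (replicate m c @ w) j = c"
  by (simp add: per_def nth_append)

text \<open>If \<open>lb\<close> is far from both ends of the rotated word, both rays of its axis
  follow those of \<open>a\<close> for a long time, and continuity of \<open>f\<close> at the line
  of \<open>a\<close> applies.\<close>

lemma line_val_anb_tendsto:
  assumes N: "N \<ge> 2" and f: "f \<in> Cc N" and p: "reduced N p" and \<epsilon>: "\<epsilon> > 0"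
  shows "\<exists>k. \<forall>n i. k \<le> i \<longrightarrow> i + k \<le> n \<longrightarrow>
    \<bar>line_val f p (rotate i (anb n)) - line_val f p [la]\<bar> < \<epsilon>"
proof -
  have pa: "positive_word N [la]" using simple_word_la[OF N] by (simp add: simple_word_def)
  \<comment> \<open>\<open>adm\<close> sees only the first and the last letter of the rotated word;
    both are \<open>la\<close> once \<open>lb\<close> is at neither end.\<close>
  have adm_eq: "adm p (rotate i (anb n)) \<longleftrightarrow> adm p [la]" if "1 \<le> i" "i + 1 \<le> n" for i n
    using that unfolding adm_def by (simp add: rotate_anb hd_append)
  show ?thesis
  proof (cases "adm p [la]")
    case False
    then have "\<bar>line_val f p (rotate i (anb n)) - line_val f p [la]\<bar> < \<epsilon>" if "1 \<le> i" "i + 1 \<le> n" for i n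
      using adm_eq[OF that] \<epsilon> by (simp add: line_val_def)
    then show ?thesis by blast
  next
    case True
    let ?x = "prep p (per [la])" and ?y = "prep p (per (winv [la]))"
    define W where "W = {A \<in> CN N. f A \<in> ball (f (line p [la])) \<epsilon>}"
    have "openin (CN_top N) W"
      unfolding W_def using f openin_continuous_map_preimage[of "CN_top N" euclideanreal f
          "ball (f (line p [la])) \<epsilon>"]
      by (simp add: Cc_def del: mem_ball)
    moreover have "{?x, ?y} \<in> W"
      using line_CN[OF pa p True] \<epsilon> by (simp add: W_def line_def)
    ultimately have "\<exists>k. \<forall>x'\<in>bdry N. \<forall>y'\<in>bdry N. x' \<noteq> y' \<longrightarrow>
        (\<forall>i<k. x' i = ?x i \<and> y' i = ?y i) \<longrightarrow> {x', y'} \<in> W"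
      by (rule openin_CN_doubleton_nbhd)
    then obtain k where k: "\<forall>x'\<in>bdry N. \<forall>y'\<in>bdry N. x' \<noteq> y' \<longrightarrow>
        (\<forall>i<k. x' i = ?x i \<and> y' i = ?y i) \<longrightarrow> {x', y'} \<in> W" ..
    \<comment> \<open>\<open>Suc k\<close> rather than \<open>k\<close>, so that
      \<open>adm_eq\<close> applies even when \<open>k\<close> is 0.\<close>
    have "\<bar>line_val f p (rotate i (anb n)) - line_val f p [la]\<bar> < \<epsilon>"
      if i: "Suc k \<le> i" "i + Suc k \<le> n" for i n
    proof -
      define v where "v = rotate i (anb n)"
      have v: "v = replicate (n - i) la @ [lb] @ replicate i la"
        unfolding v_def using i by (intro rotate_anb) simp
      have posv: "positive_word N v"
        unfolding v_def using simple_word_anb[OF N] by (simp add: simple_word_def positive_rotate)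
      have admv: "adm p v" unfolding v_def using adm_eq[of i n] i True by simp
      have wv: "winv v = replicate i (inv_letter la) @ [inv_letter lb] @ replicate (n - i) (inv_letter la)"
        unfolding v by (simp add: winv_def)
      have fwd: "per v j = la" if "j < k" for j
        unfolding v using that i by (intro per_append_replicate) simp
      have bwd: "per (winv v) j = inv_letter la" if "j < k" for j
        unfolding wv using that i by (intro per_append_replicate) simp
      have "line p v \<in> W"
        unfolding line_def
      proof (rule k[rule_format])
        show "prep p (per v) \<in> bdry N" "prep p (per (winv v)) \<in> bdry N"
          using line_subset_bdry[OF posv p admv] by (auto simp: line_def)
        show "prep p (per v) \<noteq> prep p (per (winv v))" by (rule line_two_points[OF posv])
        show "prep p (per v) j = ?x j \<and> prep p (per (winv v)) j = ?y j" if "j < k" for j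
          using that fwd bwd by (auto simp: prep_def per_single)
      qed
      then show ?thesis
        unfolding v_def[symmetric] line_val_def using True admv
        by (simp add: W_def dist_real_def abs_minus_commute)
    qed
    then show ?thesis by blast
  qed
qed

text \<open>The factor \<open>1 / real (Suc n)\<close> divides by the number of rotations of
  \<open>anb n\<close>, so each path contributes an average. The word \<open>[la]\<close> has one
  rotation, so its integral is the sum of the limits.\<close>

lemma scaled_eta_anb_tendsto:
  assumes N: "N \<ge> 2" and f: "f \<in> Cc N"
  shows "(\<lambda>n. \<integral>A. f A \<partial>meas_scale N (1 / real (Suc n)) (eta N (cyc N (anb n))))
    \<longlonglongrightarrow> (\<integral>A. f A \<partial>eta N (cyc N [la]))"
proof -
  obtain m where m: "\<And>A. A \<in> CN N \<Longrightarrow> f A \<noteq> 0 \<Longrightarrow> \<exists>x\<in>A. \<exists>y\<in>A. \<exists>i<m. x i \<noteq> y i"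
    by (rule Cc_support[OF f]) blast
  obtain B where B: "\<And>A. A \<in> CN N \<Longrightarrow> \<bar>f A\<bar> \<le> B" by (rule Cc_bounded[OF f]) blast
  let ?R = "{p. reduced N p \<and> length p < m}"
  have int: "(\<integral>A. f A \<partial>eta N (cyc N u)) = (\<Sum>p\<in>?R. \<Sum>i<length u. line_val f p (rotate i u))"
    if "simple_word N u" for u
    by (rule integral_eta_cyc[OF that f]) (rule m)
  have pos: "positive_word N (rotate i (anb n))" for i n
    using simple_word_anb[OF N] by (simp add: simple_word_def positive_rotate)
  have bound: "\<bar>line_val f p (rotate i (anb n))\<bar> \<le> \<bar>B\<bar>" if "reduced N p" for p i n
    using B[OF line_CN[OF pos that]]
    by (auto simp: line_val_def intro: order_trans[OF _ abs_ge_self])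
  have "(\<lambda>n. \<Sum>p\<in>?R. (\<Sum>i\<le>n. line_val f p (rotate i (anb n))) / real (Suc n))
      \<longlonglongrightarrow> (\<Sum>p\<in>?R. line_val f p [la])"
    using line_val_anb_tendsto[OF N f] bound
    by (intro tendsto_sum average_tendsto[where B = "\<bar>B\<bar>"]) auto
  moreover have "(\<integral>A. f A \<partial>meas_scale N (1 / real (Suc n)) (eta N (cyc N (anb n)))) =
      (\<Sum>p\<in>?R. (\<Sum>i\<le>n. line_val f p (rotate i (anb n))) / real (Suc n))" for n
  proof -
    have "(\<integral>A. f A \<partial>meas_scale N (1 / real (Suc n)) (eta N (cyc N (anb n)))) =
      (1 / real (Suc n)) * (\<integral>A. f A \<partial>eta N (cyc N (anb n)))"
      by (intro integral_meas_scale[OF _ _ f]) simp_all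
    also have "\<dots> = (1 / real (Suc n)) * (\<Sum>p\<in>?R. \<Sum>i\<le>n. line_val f p (rotate i (anb n)))"
      by (subst int[OF simple_word_anb[OF N]]) (simp only: length_anb lessThan_Suc_atMost)
    finally show ?thesis by (simp add: sum_divide_distrib del: of_nat_Suc)
  qed
  moreover have "(\<integral>A. f A \<partial>eta N (cyc N [la])) = (\<Sum>p\<in>?R. line_val f p [la])"
    by (subst int[OF simple_word_la[OF N]]) simp
  ultimately show ?thesis by simp
qed

section \<open>Intersections\<close>

definition bexp :: "word \<Rightarrow> int" where
  "bexp w = (\<Sum>c\<leftarrow>w. if fst c = 1 then (if snd c then -1 else 1) else 0)"

lemma bexp_simps [simp]: "bexp [] = 0" "bexp (v @ w) = bexp v + bexp w"
  "bexp (c # w) = (if fst c = 1 then (if snd c then -1 else 1) else 0) + bexp w"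
  by (simp_all add: bexp_def)

lemma bexp_winv [simp]: "bexp (winv w) = - bexp w"
  by (induction w) auto

lemma bexp_cons_red: "bexp (cons_red c w) = bexp [c] + bexp w"
  by (cases w) (auto simp: cons_red_def)

lemma bexp_mult: "bexp (mult_word g h) = bexp g + bexp h"
  by (induction g) (auto simp: bexp_cons_red)

lemma bexp_wpow: "bexp (wpow w k) = int k * bexp w"
  by (induction k) (auto simp: algebra_simps)

lemma bexp_anb: "bexp (anb n) = 1"
proof -
  have "bexp (replicate n la) = 0" by (induction n) auto
  then show ?thesis by (simp add: anb_def)
qed

lemma cyc_anb_Int_conj:
  assumes N: "N \<ge> 2" and g: "reduced N g"
  shows "cyc N (anb n) \<inter> conjg N g (cyc N [la]) = {[]}"
proof -
  have pa: "positive_word N [la]" using simple_word_la[OF N] by (simp add: simple_word_def)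
  have pu: "positive_word N (anb n)" using simple_word_anb[OF N] by (simp add: simple_word_def)
  have "x = []" if x: "x \<in> cyc N (anb n)" "x \<in> conjg N g (cyc N [la])" for x
  proof -
    obtain y where y: "y \<in> cyc N [la]" "x = mult_word (mult_word g y) (winv g)"
      using x(2) unfolding conjg_eq[OF g] by blast
    have "bexp y = 0" using y(1) unfolding cyc_positive[OF pa] by (auto simp: bexp_wpow)
    then have b0: "bexp x = 0" using y(2) by (simp add: bexp_mult)
    obtain k where k: "x = wpow (anb n) k \<or> x = wpow (winv (anb n)) k"
      using x(1) unfolding cyc_positive[OF pu] by blast
    then have "bexp x = int k \<or> bexp x = - int k" by (auto simp: bexp_wpow bexp_anb)
    then have "k = 0" using b0 by simp
    then show ?thesis using k by auto
  qed
  moreover have "[] \<in> cyc N (anb n)" using generate.one[of "FN N" "{anb n}"] by simp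
  moreover have "[] \<in> conjg N g (cyc N [la])"
  proof -
    have "[] \<in> cyc N [la]" using generate.one[of "FN N" "{[la]}"] by simp
    moreover have "mult_word (mult_word g []) (winv g) = []"
      using mult_word_reduced_append[of N g "[]"] mult_word_winv[of N "winv g"] g by simp
    ultimately show ?thesis unfolding conjg_eq[OF g] by (metis image_eqI)
  qed
  ultimately show ?thesis by blast
qed

lemma dcoset_rep:
  assumes "D \<in> dcosets N H K"
  shows "reduced N (dcoset_rep N H K D)" "dcoset N H (dcoset_rep N H K D) K = D"
proof -
  have "\<exists>g. g \<in> carrier (FN N) \<and> D = dcoset N H g K" using assms by (auto simp: dcosets_def)
  from someI_ex[OF this] show "reduced N (dcoset_rep N H K D)" "dcoset N H (dcoset_rep N H K D) K = D"
    unfolding dcoset_rep_def by auto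
qed

lemma dcoset_eq:
  "dcoset N H g K = {mult_word h (mult_word g k) | h k. h \<in> H \<and> k \<in> K}"
  by (auto simp: dcoset_def set_mult_def l_coset_def)

text \<open>The representative is an unspecified choice and need not be \<open>[]\<close>. Lying in
  \<open>H\<close> is enough for conjugation by it to fix \<open>H\<close>.\<close>

lemma dcoset_rep_trivial:
  assumes H: "subgroup H (FN N)"
  shows "dcoset_rep N H H (dcoset N H [] H) \<in> H"
proof -
  interpret H: subgroup H "FN N" by (rule H)
  define g where "g = dcoset_rep N H H (dcoset N H [] H)"
  have "dcoset N H [] H \<in> dcosets N H H" by (auto simp: dcosets_def)
  note rep = dcoset_rep[OF this, folded g_def]
  have "[] \<in> H" using H.one_closed by simp
  then have "mult_word [] (mult_word g []) \<in> dcoset N H g H" unfolding dcoset_eq by blast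
  then have "g \<in> dcoset N H [] H"
    using rep mult_word_reduced_append[of N g "[]"] by simp
  then have "g \<in> H" unfolding dcoset_eq using H.m_closed by auto
  then show ?thesis by (simp add: g_def)
qed

lemma fg_subgroup_cyc: "positive_word N u \<Longrightarrow> fg_subgroup N (cyc N u)"
  unfolding fg_subgroup_def using subgroup_cyc[of N u] reduced_positive[of N u]
  by (auto intro!: exI[of _ "{u}"])

theorem mainTheorem3:
  fixes N :: nat
    and P :: "bpoint set measure \<Rightarrow> bpoint set measure \<Rightarrow> bpoint set measure"
  assumes "N \<ge> 2"
    and "bilinear_SCurr N P"
    and "\<And>H K. fg_subgroup N H \<Longrightarrow> H \<noteq> {\<one>\<^bsub>FN N\<^esub>} \<Longrightarrow>
                fg_subgroup N K \<Longrightarrow> K \<noteq> {\<one>\<^bsub>FN N\<^esub>} \<Longrightarrow>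
           P (eta N H) (eta N K) =
             meas_sum N (dcosets N H K)
               (\<lambda>D. eta N (H \<inter> conjg N (dcoset_rep N H K D) K))"
  shows "\<not> continuous_map (prod_topology (SCurr_top N) (SCurr_top N)) (SCurr_top N)
            (\<lambda>(\<mu>, \<nu>). P \<mu> \<nu>)"
proof
  assume cont: "continuous_map (prod_topology (SCurr_top N) (SCurr_top N)) (SCurr_top N)
            (\<lambda>(\<mu>, \<nu>). P \<mu> \<nu>)"
  note N = assms(1) and bil = assms(2)
  define H where "H = cyc N [la]"
  define V where "V = hit2 N [la] [inv_letter la]"
  define \<mu> where "\<mu> n = meas_scale N (1 / real (Suc n)) (eta N (cyc N (anb n)))" for n
  have pa: "positive_word N [la]" using simple_word_la[OF N] by (simp add: simple_word_def)
  have pu: "positive_word N (anb n)" for n using simple_word_anb[OF N] by (simp add: simple_word_def)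
  have disj: "cyl N [la] \<inter> cyl N [inv_letter la] = {}" by (auto simp: cyl_def)
  have f: "indicator V \<in> Cc N" unfolding V_def by (rule indicator_hit2_Cc[OF disj])
  have Vs: "V \<in> sets (CN_borel N)" unfolding V_def by (rule openin_sets_CN_borel[OF openin_hit2])
  have \<eta>: "eta N H \<in> SCurr N" unfolding H_def by (rule eta_cyc_SCurr[OF simple_word_la[OF N]])
  have \<eta>u: "eta N (cyc N (anb n)) \<in> SCurr N" for n by (rule eta_cyc_SCurr[OF simple_word_anb[OF N]])
  have \<mu>: "\<mu> n \<in> SCurr N" for n unfolding \<mu>_def by (rule meas_scale_SCurr[OF \<eta>u])
  have fgH: "fg_subgroup N H" "H \<noteq> {\<one>\<^bsub>FN N\<^esub>}"
    unfolding H_def using fg_subgroup_cyc[OF pa] cyc_nontrivial[OF pa] by simp_all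
  have "limitin (SCurr_top N) \<mu> (eta N H) sequentially"
    using \<mu> \<eta> scaled_eta_anb_tendsto[OF N] unfolding \<mu>_def H_def by (rule limitin_SCurr_top)
  moreover have "limitin (SCurr_top N) (\<lambda>_::nat. eta N H) (eta N H) sequentially"
    by (rule limitin_SCurr_top) (use \<eta> in auto)
  ultimately have "limitin (prod_topology (SCurr_top N) (SCurr_top N)) (\<lambda>n. (\<mu> n, eta N H))
      (eta N H, eta N H) sequentially"
    by (simp add: limitin_pairwise o_def)
  from continuous_map_limit[OF cont this]
  have lim: "limitin (SCurr_top N) (\<lambda>n. P (\<mu> n) (eta N H)) (P (eta N H) (eta N H)) sequentially"
    by (simp add: o_def)

  have zero: "(\<integral>A. indicator V A \<partial>P (\<mu> n) (eta N H)) = (0::real)" for n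
  proof -
    let ?u = "cyc N (anb n)"
    let ?Q = "P (eta N ?u) (eta N H)"
    have Q: "?Q = meas_sum N (dcosets N ?u H) (\<lambda>D. eta N (?u \<inter> conjg N (dcoset_rep N ?u H D) H))"
      using fg_subgroup_cyc[OF pu] cyc_nontrivial[OF pu] by (intro assms(3) fgH) simp_all
    have top: "CN N \<in> sets (CN_borel N)" using sets.top[of "CN_borel N"] by simp
    \<comment> \<open>Every double coset contributes the current of the trivial group, so the
      product is a null measure, and it remains one after scaling.\<close>
    have "emeasure (eta N (?u \<inter> conjg N (dcoset_rep N ?u H D) H)) (CN N) = 0"
      if "D \<in> dcosets N ?u H" for D
    proof -
      have "?u \<inter> conjg N (dcoset_rep N ?u H D) H = {[]}"
        unfolding H_def using cyc_anb_Int_conj[OF N] dcoset_rep(1)[OF that] by (simp add: H_def)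
      then show ?thesis by (simp add: eta_def emeasure_meas_zero)
    qed
    then have "emeasure ?Q (CN N) = 0"
      unfolding Q emeasure_meas_sum[OF sets_eta top]
      by (simp cong: nn_integral_cong_simp)
    moreover have "P (\<mu> n) (eta N H) = meas_scale N (1 / real (Suc n)) ?Q"
      using bil \<eta>u[of n] \<eta> unfolding bilinear_SCurr_def \<mu>_def by simp
    moreover have "sets ?Q = sets (CN_borel N)" unfolding Q by simp
    ultimately have "P (\<mu> n) (eta N H) = scale_measure (ennreal (1 / real (Suc n))) ?Q"
      using meas_scale_eq by simp
    moreover have "space ?Q = CN N" unfolding Q by simp
    ultimately show ?thesis
      using \<open>emeasure ?Q (CN N) = 0\<close> by (intro integral_null) (simp add: space_scale_measure)
  qed

  have pos: "(\<integral>A. indicator V A \<partial>P (eta N H) (eta N H)) > (0::real)"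
  proof -
    let ?Q = "P (eta N H) (eta N H)"
    define D where "D = dcoset N H [] H"
    have subH: "subgroup H (FN N)" unfolding H_def by (rule subgroup_cyc[OF pa])
    have Q: "?Q = meas_sum N (dcosets N H H) (\<lambda>D. eta N (H \<inter> conjg N (dcoset_rep N H H D) H))"
      by (intro assms(3) fgH)
    \<comment> \<open>The trivial double coset alone already contributes a copy of
      \<open>eta N H\<close>; the remaining terms are nonnegative.\<close>
    have D: "D \<in> dcosets N H H" by (auto simp: D_def dcosets_def)
    have HD: "H \<inter> conjg N (dcoset_rep N H H D) H = H"
      unfolding D_def using conjg_subgroup_self[OF subH dcoset_rep_trivial[OF subH]] by simp
    let ?L = "\<lambda>(p, i). line p (rotate i [la])"
    have L: "?L \<in> measurable (count_space (params N [la])) (CN_borel N)"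
      using line_params_CN[OF pa] by auto
    \<comment> \<open>These parameters describe the axis of \<open>a\<close> through the base point,
      whose ends start with \<open>la\<close> and with its inverse.\<close>
    have param: "([], 0) \<in> params N [la]" by (simp add: params_def)
    have "line [] [la] \<in> V"
    proof -
      have "prep [] (per [la]) \<in> cyl N [la]" "prep [] (per (winv [la])) \<in> cyl N [inv_letter la]"
        using line_subset_bdry[OF pa, of "[]"] by (auto simp: line_def cyl_def prep_def per_single)
      then show ?thesis
        using line_params_CN[OF pa param] unfolding V_def hit2_def by (auto simp: line_def)
    qed
    then have sub: "{([], 0)} \<subseteq> ?L -` V \<inter> params N [la]" using param by auto
    have "1 = emeasure (count_space (params N [la])) {([], 0)}"
      using param by (simp add: emeasure_count_space_finite)
    also have "\<dots> \<le> emeasure (count_space (params N [la])) (?L -` V \<inter> params N [la])"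
      using sub by (intro emeasure_mono) auto
    also have "\<dots> = emeasure (eta N H) V"
      unfolding H_def eta_cyc_params[OF simple_word_la[OF N]] using L Vs by (simp add: emeasure_distr)
    also have "\<dots> = emeasure (eta N (H \<inter> conjg N (dcoset_rep N H H D) H)) V" by (simp only: HD)
    also have "\<dots> \<le> emeasure ?Q V"
      unfolding Q emeasure_meas_sum[OF sets_eta Vs] by (rule nn_integral_ge_point[OF D])
    finally have ge: "1 \<le> emeasure ?Q V" .
    \<comment> \<open>The real integral of the indicator is \<open>measure ?Q V\<close>, which would
      be 0 by convention if \<open>emeasure ?Q V\<close> were infinite. Compactness of
      \<open>V\<close> excludes this.\<close>
    have "?Q \<in> SCurr N" using bil \<eta> by (simp add: bilinear_SCurr_def)
    then have "emeasure ?Q V < \<infinity>"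
      using compactin_hit2[OF disj] by (simp add: SCurr_def V_def)
    then have "measure ?Q V > 0"
      using ge by (auto simp: measure_def enn2real_positive_iff intro: less_le_trans[OF zero_less_one])
    moreover have "V \<inter> space ?Q = V" using Vs sets.sets_into_space[of V ?Q] unfolding Q by auto
    ultimately show ?thesis by simp
  qed

  \<comment> \<open>An open neighbourhood of the limit that contains no term of the sequence, as all
    their integrals vanish.\<close>
  let ?W = "{\<mu> \<in> SCurr N. (\<integral>A. indicator V A \<partial>\<mu>) \<in> {0::real<..}}"
  have "openin (SCurr_top N) ?W"
    unfolding SCurr_top_def
    by (rule topology_generated_by_Basis)
      (intro CollectI exI[of _ "indicator V"] exI[of _ "{0<..}"] conjI refl f open_greaterThan)
  moreover have "P (eta N H) (eta N H) \<in> ?W"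
    using bil \<eta> pos by (simp add: bilinear_SCurr_def)
  ultimately have "\<forall>\<^sub>F n in sequentially. P (\<mu> n) (eta N H) \<in> ?W"
    using lim by (simp only: limitin_def)
  then obtain n where "P (\<mu> n) (eta N H) \<in> ?W" by (auto simp: eventually_sequentially)
  then show False using zero[of n] by simp
qed

end
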